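(* Let $I=\,]a,b[\,\subset\mathbb{R}$ be an open bounded interval and let $p\colon I\to\mathbb{R}$ be measurable with $p^-=\operatorname{ess\,inf}_I p$, $p^+=\operatorname{ess\,sup}_I p$ and $1<p^-\le p^+<\infty$. Suppose the conductivity $\gamma\in L^\infty(I)$ is almost everywhere bounded from below by a positive constant. Suppose further that the exponent $p(\cdot)$ reaches its essential minimum $p^-$ on a set $Q_+=\{x\in I: p(x)=p^-\}$ of positive measure and its essential maximum $p^+$ on a set $Q_-=\{x\in I: p(x)=p^+\}$ of positive measure. Then the Dirichlet-to-Neumann map $\Lambda_\gamma$ satisfies $$\lim_{m\to\infty}\overline K_m^{\,-p^-/(p^--1)}\frac{1}{|Q_+|}\Lambda_\gamma(m)=\left(\frac{1}{|Q_+|}\int_{Q_+}\gamma(x)^{-1/(p(x)-1)}\,dx\right)^{-(p^--1)}$$ and $$\lim_{m\to 0}\overline K_m^{\,-p^+/(p^+-1)}\frac{1}{|Q_-|}\Lambda_\gamma(m)=\left(\frac{1}{|Q_-|}\int_{Q_-}\gamma(x)^{-1/(p(x)-1)}\,dx\right)^{-(p^+-1)},$$ where $m>0$ is the difference between the Dirichlet boundary values and $\overline K_m$, which can be computed from knowledge of $m$ and $p(\cdot)$ alone, is the unique positive number with $m=\int_a^b\overline K_m^{\,1/(p(x)-1)}\,dx$.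
   Context: $|Q|$ denotes Lebesgue measure. For $A\le B$ let $u$ be the unique minimizer of $\int_I\frac{\gamma(x)}{p(x)}|u'(x)|^{p(x)}\,dx$ among $u$ in the variable exponent Sobolev space $W^{1,p(\cdot)}(I)$ with $u(a)=A$, $u(b)=B$ (the weak solution of $-(\gamma|u'|^{p(x)-2}u')'=0$ in $I$ with these boundary values). The Dirichlet-to-Neumann map is $\Lambda_\gamma(A,B)=\int_a^b\gamma(x)|u'(x)|^{p(x)}\,dx$. It depends only on $m=B-A\ge 0$, and one writes $\Lambda_\gamma(m)$. The limit $m\to0$ is through positive $m$. *)

theory Defs
  imports "HOL-Analysis.Analysis" "HOL-Probability.Essential_Supremum"
begin

definition essinf :: "'a measure \<Rightarrow> ('a \<Rightarrow> ereal) \<Rightarrow> ereal" where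
  "essinf M f = - esssup M (\<lambda>x. - f x)"

text \<open>Smooth functions with compact support in the open interval \<open>]a,b[\<close>, extended by zero
  to the real line.\<close>

definition test_functions :: "real \<Rightarrow> real \<Rightarrow> (real \<Rightarrow> real) set" where
  "test_functions a b =
     {\<phi>. (\<forall>n. (deriv ^^ n) \<phi> differentiable_on UNIV) \<and>
         compact (closure {x. \<phi> x \<noteq> 0}) \<and> closure {x. \<phi> x \<noteq> 0} \<subseteq> {a<..<b}}"

definition locally_integrable :: "real \<Rightarrow> real \<Rightarrow> (real \<Rightarrow> real) \<Rightarrow> bool" where
  "locally_integrable a b u \<longleftrightarrow>
     (\<forall>K. compact K \<and> K \<subseteq> {a<..<b} \<longrightarrow> set_integrable lebesgue K u)"

definition has_weak_deriv :: "real \<Rightarrow> real \<Rightarrow> (real \<Rightarrow> real) \<Rightarrow> (real \<Rightarrow> real) \<Rightarrow> bool" where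
  "has_weak_deriv a b u g \<longleftrightarrow>
     locally_integrable a b u \<and> locally_integrable a b g \<and>
     (\<forall>\<phi>\<in>test_functions a b.
        (\<integral>x. u x * deriv \<phi> x \<partial>lebesgue_on {a<..<b})
          = - (\<integral>x. g x * \<phi> x \<partial>lebesgue_on {a<..<b}))"

text \<open>Weak derivatives are unique up to null sets; the choice of a representative is irrelevant,
  since below it only occurs under integrals and in integrability conditions.\<close>

definition weak_deriv :: "real \<Rightarrow> real \<Rightarrow> (real \<Rightarrow> real) \<Rightarrow> real \<Rightarrow> real" where
  "weak_deriv a b u = (SOME g. has_weak_deriv a b u g)"

definition Lp_var :: "real \<Rightarrow> real \<Rightarrow> (real \<Rightarrow> real) \<Rightarrow> (real \<Rightarrow> real) set" where
  "Lp_var a b p =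
     {f. f \<in> borel_measurable (lebesgue_on {a<..<b}) \<and>
         (\<exists>c>0. integrable (lebesgue_on {a<..<b}) (\<lambda>x. \<bar>c * f x\<bar> powr p x))}"

definition W1p_var :: "real \<Rightarrow> real \<Rightarrow> (real \<Rightarrow> real) \<Rightarrow> (real \<Rightarrow> real) set" where
  "W1p_var a b p =
     {u. u \<in> Lp_var a b p \<and> (\<exists>g. has_weak_deriv a b u g \<and> g \<in> Lp_var a b p)}"

text \<open>Elements of the Sobolev space are functions up to null sets, so the boundary values are
  those of the representative that is continuous on the closed interval.\<close>

definition has_boundary_values ::
    "real \<Rightarrow> real \<Rightarrow> (real \<Rightarrow> real) \<Rightarrow> real \<Rightarrow> real \<Rightarrow> bool" where
  "has_boundary_values a b u A B \<longleftrightarrow>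
     (\<exists>v. continuous_on {a..b} v \<and> (AE x in lebesgue_on {a<..<b}. u x = v x) \<and>
          v a = A \<and> v b = B)"

text \<open>For bounded \<open>\<gamma>\<close> and essentially bounded \<open>p\<close> with \<open>ess inf p > 1\<close>, the integrand below is
  integrable for every \<open>u\<close> in the Sobolev space.\<close>

definition energy ::
    "real \<Rightarrow> real \<Rightarrow> (real \<Rightarrow> real) \<Rightarrow> (real \<Rightarrow> real) \<Rightarrow> (real \<Rightarrow> real) \<Rightarrow> real" where
  "energy a b p \<gamma> u =
     (\<integral>x. \<gamma> x / p x * \<bar>weak_deriv a b u x\<bar> powr p x \<partial>lebesgue_on {a<..<b})"

definition is_minimizer ::
    "real \<Rightarrow> real \<Rightarrow> (real \<Rightarrow> real) \<Rightarrow> (real \<Rightarrow> real) \<Rightarrow> real \<Rightarrow> real \<Rightarrow> (real \<Rightarrow> real) \<Rightarrow> bool" where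
  "is_minimizer a b p \<gamma> A B u \<longleftrightarrow>
     u \<in> W1p_var a b p \<and> has_boundary_values a b u A B \<and>
     (\<forall>v. v \<in> W1p_var a b p \<and> has_boundary_values a b v A B \<longrightarrow>
          energy a b p \<gamma> u \<le> energy a b p \<gamma> v)"

text \<open>Minimizers are unique only up to null sets, hence the definite description is over the
  value of the integral rather than over \<open>u\<close>.\<close>

definition DN_map ::
    "real \<Rightarrow> real \<Rightarrow> (real \<Rightarrow> real) \<Rightarrow> (real \<Rightarrow> real) \<Rightarrow> real \<Rightarrow> real \<Rightarrow> real" where
  "DN_map a b p \<gamma> A B =
     (THE L. \<exists>u. is_minimizer a b p \<gamma> A B u \<and>
        L = (\<integral>x. \<gamma> x * \<bar>weak_deriv a b u x\<bar> powr p x \<partial>lebesgue_on {a<..<b}))"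

text \<open>The common value of the Dirichlet-to-Neumann map on all boundary data with difference \<open>m\<close>.\<close>

definition DN_diff ::
    "real \<Rightarrow> real \<Rightarrow> (real \<Rightarrow> real) \<Rightarrow> (real \<Rightarrow> real) \<Rightarrow> real \<Rightarrow> real" where
  "DN_diff a b p \<gamma> m = (THE L. \<forall>A B. B - A = m \<longrightarrow> DN_map a b p \<gamma> A B = L)"

definition is_Kbar :: "real \<Rightarrow> real \<Rightarrow> (real \<Rightarrow> real) \<Rightarrow> real \<Rightarrow> real \<Rightarrow> bool" where
  "is_Kbar a b p m K \<longleftrightarrow>
     K > 0 \<and> m = (\<integral>x. K powr (1 / (p x - 1)) \<partial>lebesgue_on {a<..<b})"

definition Kbar :: "real \<Rightarrow> real \<Rightarrow> (real \<Rightarrow> real) \<Rightarrow> real \<Rightarrow> real" where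
  "Kbar a b p m = (THE K. is_Kbar a b p m K)"

end

theory Submission
  imports Defs
begin

text \<open>The minimizer satisfies \<open>\<gamma> \<bar>u'\<bar>\<^sup>p\<^sup>-\<^sup>1 = K\<close> for a constant flux \<open>K\<close>, that is
  \<open>u' = (K / \<gamma>)\<^sup>q\<close> with \<open>q = 1 / (p - 1)\<close>, and \<open>K\<close> is determined by
  \<open>m = \<integral> \<gamma>\<^sup>-\<^sup>q K\<^sup>q\<close>. Consequently \<open>\<Lambda>(m) = \<integral> \<gamma> \<bar>u'\<bar>\<^sup>p = K m\<close>. As \<open>K\<close> tends to infinity, dominated convergence shows
  that \<open>m / K\<^sup>\<beta>\<close>, where \<open>\<beta>\<close> is the essential maximum of \<open>q\<close>, tends to the integral of \<open>\<gamma>\<^sup>-\<^sup>q\<close> over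
  the set where \<open>q = \<beta>\<close>; the same with \<open>\<gamma>\<close> replaced by 1 applies to \<open>Kbar\<close>, and the limit follows by
  comparing the two. The limit at 0 is the same with the essential minimum of \<open>q\<close>.\<close>

subsection \<open>Smooth step functions\<close>

text \<open>Minimality is verified by convexity: the energy density lies above its tangent at the
  candidate derivative, the tangent has the constant slope K, and the integral of \<open>u'\<close>
  is fixed by the boundary values. Strict convexity makes the derivative of the minimizer unique
  almost everywhere, which the definite description in \<open>DN_map\<close> relies on. The obstacle
  is \<open>weak_deriv\<close>, an arbitrary choice: its almost everywhere uniqueness, the equality
  of the integral of \<open>u'\<close> with B - A, and the weak differentiability of antiderivatives
  have to be obtained from test functions. Those have derivatives of every order, hence the smooth
  step constructed here. For the final comparison put \<beta> = 1/(r - 1) with r the extreme value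
  of p. As m/K^\<beta> and m/Kbar^\<beta> tend to W and |Q|, the power (K/Kbar)^\<beta> tends to
  |Q|/W, and Kbar^(-1-\<beta>) K m = (m/Kbar^\<beta>)(K/Kbar). The normalising exponent r/(r - 1) is
  1 + \<beta>.\<close>

definition smooth :: "(real \<Rightarrow> real) \<Rightarrow> bool" where
  "smooth f \<longleftrightarrow> (\<forall>n. (deriv ^^ n) f differentiable_on UNIV)"

text \<open>Smoothness is proved by naming a set of functions closed under differentiation, which
  avoids formulas for the higher derivatives.\<close>

lemma smooth_coinduct:
  assumes "f \<in> C"
    and step: "\<And>f. f \<in> C \<Longrightarrow> \<exists>f'\<in>C. \<forall>x. (f has_real_derivative f' x) (at x)"
  shows "smooth f"
proof -
  have deriv_mem: "deriv h \<in> C \<and> h differentiable_on UNIV" if h: "h \<in> C" for h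
  proof -
    obtain h' where h': "h' \<in> C" "\<And>x. (h has_real_derivative h' x) (at x)"
      using step[OF h] by blast
    then have "deriv h = h'" by (auto intro!: ext DERIV_imp_deriv)
    moreover have "h differentiable_on UNIV"
      using h'(2) by (auto simp: differentiable_on_def real_differentiable_def intro: exI)
    ultimately show ?thesis using h'(1) by simp
  qed
  have "(deriv ^^ n) f \<in> C" for n
    by (induction n) (use \<open>f \<in> C\<close> deriv_mem in auto)
  then show ?thesis using deriv_mem by (auto simp: smooth_def)
qed

lemma smooth_has_deriv:
  assumes "smooth f"
  shows "(f has_real_derivative deriv f x) (at x)"
proof -
  have "f differentiable_on UNIV" using assms[unfolded smooth_def, rule_format, of 0] by simp
  then have "f differentiable (at x)" by (simp add: differentiable_on_def)
  then show ?thesis using DERIV_deriv_iff_real_differentiable by blast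
qed

lemma smooth_deriv: "smooth f \<Longrightarrow> smooth (deriv f)"
  unfolding smooth_def by (metis comp_apply funpow_Suc_right)

lemma smooth_continuous_on: "smooth f \<Longrightarrow> continuous_on X f"
  by (intro continuous_at_imp_continuous_on ballI DERIV_isCont[OF smooth_has_deriv])

lemma smooth_antideriv:
  assumes f: "\<And>x. (f has_real_derivative g x) (at x)" and "smooth g"
  shows "smooth f"
proof (rule smooth_coinduct[of f "insert f {h. smooth h}"])
  fix h assume "h \<in> insert f {h. smooth h}"
  then show "\<exists>f'\<in>insert f {h. smooth h}. \<forall>x. (h has_real_derivative f' x) (at x)"
    using f \<open>smooth g\<close> smooth_has_deriv smooth_deriv by blast
qed simp

text \<open>The invariant set has to leave the coefficients c and d free, since every
  differentiation multiplies them by n and m.\<close>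

lemma smooth_affine_diff:
  assumes "smooth f" "smooth g"
  shows "smooth (\<lambda>x. c * f (n * (x - s)) - d * g (m * (x - t)))"
proof (rule smooth_coinduct[where C = "{\<lambda>x. c * f (n * (x - s)) - d * g (m * (x - t)) |c d f g. smooth f \<and> smooth g}"])
  fix h assume "h \<in> {\<lambda>x. c * f (n * (x - s)) - d * g (m * (x - t)) |c d f g. smooth f \<and> smooth g}"
  then obtain c d f g where h: "h = (\<lambda>x. c * f (n * (x - s)) - d * g (m * (x - t)))" "smooth f" "smooth g"
    by auto
  have "(h has_real_derivative ((c * n) * deriv f (n * (x - s)) - (d * m) * deriv g (m * (x - t)))) (at x)" for x
    unfolding h(1)
  proof -
    have aff: "((\<lambda>x. k * (x - r)) has_real_derivative k) (at x)" for k r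
      by (auto intro!: derivative_eq_intros)
    note ch = DERIV_chain2[OF smooth_has_deriv[OF h(2)] aff[of n s]]
      DERIV_chain2[OF smooth_has_deriv[OF h(3)] aff[of m t]]
    show "((\<lambda>x. c * f (n * (x - s)) - d * g (m * (x - t))) has_real_derivative
       ((c * n) * deriv f (n * (x - s)) - (d * m) * deriv g (m * (x - t)))) (at x)"
      using DERIV_diff[OF DERIV_cmult[OF ch(1), of c] DERIV_cmult[OF ch(2), of d]]
      by (simp add: mult_ac)
  qed
  then show "\<exists>f'\<in>{\<lambda>x. c * f (n * (x - s)) - d * g (m * (x - t)) |c d f g. smooth f \<and> smooth g}.
      \<forall>x. (h has_real_derivative f' x) (at x)"
    using smooth_deriv[OF h(2)] smooth_deriv[OF h(3)]
    by (intro bexI[where x = "\<lambda>x. (c * n) * deriv f (n * (x - s)) - (d * m) * deriv g (m * (x - t))"]) auto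
qed (use assms in blast)

text \<open>A class of functions closed under differentiation that contains the bump \<open>exp (-1/(x(1-x)))\<close>.\<close>

definition bump_class :: "real poly \<Rightarrow> nat \<Rightarrow> real \<Rightarrow> real" where
  "bump_class q k x = (if 0 < x \<and> x < 1
     then poly q x / (x * (1 - x)) ^ k * exp (- (1 / (x * (1 - x)))) else 0)"

text \<open>One term of the exponential series is at most the whole sum. Applied to 1/w it shows
  that exp(-1/w) decays faster than any power of w.\<close>

lemma power_le_fact_exp:
  fixes y :: real
  assumes "0 \<le> y"
  shows "y ^ n / fact n \<le> exp y"
proof -
  have "(\<Sum>k\<in>{n}. y ^ k /\<^sub>R fact k) \<le> (\<Sum>k. y ^ k /\<^sub>R fact k)"
    by (intro sum_le_suminf) 
      (use assms summable_exp_generic[of y] in \<open>auto simp del: real_scaleR_def simp: scaleR_nonneg_nonneg\<close>)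
  then show ?thesis by (simp add: exp_def field_simps)
qed

text \<open>With w = x(1 - x) the factor exp(-1/w) absorbs the pole w^(-k) and leaves two further
  powers of w. These make the derivative vanish at 0 and 1, where the formula is glued to
  zero.\<close>

lemma bump_class_bound:
  "\<exists>C. \<forall>x. \<bar>bump_class q k x\<bar> \<le> C * (x * (1 - x))\<^sup>2"
proof -
  obtain B where B: "\<And>x. x \<in> {0..1::real} \<Longrightarrow> \<bar>poly q x\<bar> \<le> B"
  proof -
    have "compact (poly q ` {0..1::real})"
      by (intro compact_continuous_image) (auto intro: continuous_intros)
    then obtain B where "\<forall>y\<in>poly q ` {0..1}. norm y \<le> B"
      using compact_imp_bounded bounded_iff by metis
    then show ?thesis using that by (metis image_eqI real_norm_def)
  qed
  have "B \<ge> 0" using order_trans[OF abs_ge_zero B[of 0]] by simp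
  have "\<bar>bump_class q k x\<bar> \<le> B * fact (k + 2) * (x * (1 - x))\<^sup>2" for x
  proof (cases "0 < x \<and> x < 1")
    case True
    define w where "w = x * (1 - x)"
    have w: "w > 0" using True by (simp add: w_def)
    have "(1 / w) ^ (k + 2) / fact (k + 2) \<le> exp (1 / w)"
      using w by (intro power_le_fact_exp) simp
    then have "exp (- (1 / w)) \<le> fact (k + 2) * w ^ (k + 2)"
      using w by (simp add: exp_minus divide_simps mult.commute)
    then have "exp (- (1 / w)) / w ^ k \<le> fact (k + 2) * w\<^sup>2"
      using w by (simp add: divide_simps power_add power2_eq_square mult_ac)
    then have "\<bar>poly q x\<bar> * (exp (- (1 / w)) / w ^ k) \<le> B * (fact (k + 2) * w\<^sup>2)"
      using B[of x] True w by (intro mult_mono) auto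
    then show ?thesis using True w by (simp add: bump_class_def w_def abs_mult field_simps)
  next
    case False
    then show ?thesis using \<open>B \<ge> 0\<close> by (auto simp: bump_class_def)
  qed
  then show ?thesis by blast
qed

lemma has_deriv_zero_quadratic:
  fixes f :: "real \<Rightarrow> real"
  assumes "f z = 0" and "\<And>x. \<bar>x - z\<bar> < 1 \<Longrightarrow> \<bar>f x\<bar> \<le> C * (x - z)\<^sup>2"
  shows "(f has_real_derivative 0) (at z)"
proof -
  have "((\<lambda>y. (f y - f z) / (y - z)) \<longlongrightarrow> 0) (at z)"
  proof (rule tendsto_rabs_zero_cancel, rule tendsto_sandwich[where f = "\<lambda>_. 0" and h = "\<lambda>y. \<bar>C\<bar> * \<bar>y - z\<bar>"])
    show "((\<lambda>y. \<bar>C\<bar> * \<bar>y - z\<bar>) \<longlongrightarrow> 0) (at z)"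
      by (auto intro!: tendsto_eq_intros)
    have "\<forall>\<^sub>F y in at z. \<bar>y - z\<bar> < 1"
      unfolding eventually_at by (auto simp: dist_real_def intro: exI[of _ 1])
    then show "\<forall>\<^sub>F y in at z. \<bar>(f y - f z) / (y - z)\<bar> \<le> \<bar>C\<bar> * \<bar>y - z\<bar>"
    proof eventually_elim
      case (elim y)
      have "\<bar>f y\<bar> \<le> \<bar>C\<bar> * (y - z)\<^sup>2"
        using assms(2)[OF elim] by (metis abs_ge_self mult_right_mono order_trans zero_le_power2)
      also have "\<dots> = (\<bar>C\<bar> * \<bar>y - z\<bar>) * \<bar>y - z\<bar>" by (simp add: power2_eq_square)
      finally show ?case using assms(1) by (cases "y = z") (auto simp: abs_divide divide_simps)
    qed
  qed auto
  then show ?thesis by (simp add: has_field_derivative_iff)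
qed

lemma bump_class_deriv:
  "\<exists>q' k'. \<forall>x. (bump_class q k has_real_derivative bump_class q' k' x) (at x)"
proof -
  define w where "w = (\<lambda>x::real. x * (1 - x))"
  define W where "W = [:0, 1, -1::real:]"
  define W' where "W' = [:1, -2::real:]"
  have W: "poly W x = w x" "poly W' x = 1 - 2 * x" for x
    by (auto simp: W_def w_def W'_def algebra_simps)
  \<comment> \<open>Quotient rule for q w^(-k) exp(-1/w), brought to the denominator w^(k + 2); the
    last summand comes from the exponential, whose logarithmic derivative is w'/w^2.\<close>
  define q' where "q' = pderiv q * W ^ 2 - smult (of_nat k) (q * W' * W) + q * W'"
  have inside: "(bump_class q k has_real_derivative bump_class q' (k + 2) x) (at x)" if x: "0 < x" "x < 1" for x
  proof -
    have wx: "w x > 0" using x by (simp add: w_def)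
    have dw: "(w has_real_derivative (1 - 2 * x)) (at x)"
      unfolding w_def by (auto intro!: derivative_eq_intros)
    have dwk: "((\<lambda>x. w x ^ k) has_real_derivative of_nat k * w x ^ (k - 1) * (1 - 2 * x)) (at x)"
      using DERIV_power[OF dw, of k] by (simp add: mult_ac)
    have k: "of_nat k * w x ^ (k - 1) = of_nat k * w x ^ k / w x"
      using wx by (cases k) auto
    define e where "e = exp (- (1 / w x))"
    have "((\<lambda>x. inverse (w x)) has_real_derivative - ((1 - 2 * x) * (inverse (w x))\<^sup>2)) (at x)"
      using DERIV_inverse_fun[OF dw] wx by (simp add: power2_eq_square power_inverse)
    from DERIV_fun_exp[OF DERIV_minus[OF this]]
    have de: "((\<lambda>x. exp (- (1 / w x))) has_real_derivative e * ((1 - 2 * x) / (w x)\<^sup>2)) (at x)"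
      by (simp add: e_def inverse_eq_divide power_divide)
    have "((\<lambda>x. poly q x / w x ^ k * exp (- (1 / w x))) has_real_derivative
        (poly (pderiv q) x * w x ^ k - poly q x * (real k * w x ^ (k - 1) * (1 - 2 * x)))
          / (w x ^ k * w x ^ k) * e
        + e * ((1 - 2 * x) / (w x)\<^sup>2) * (poly q x / w x ^ k)) (at x)"
      using DERIV_mult[OF DERIV_divide[OF poly_DERIV dwk] de] wx by (simp add: e_def)
    also have "(poly (pderiv q) x * w x ^ k - poly q x * (real k * w x ^ (k - 1) * (1 - 2 * x)))
          / (w x ^ k * w x ^ k) * e
        + e * ((1 - 2 * x) / (w x)\<^sup>2) * (poly q x / w x ^ k) = poly q' x / w x ^ (k + 2) * e"
      unfolding k using wx
      by (simp add: q'_def W divide_simps power_add power2_eq_square) (simp add: algebra_simps)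
    also have "\<dots> = bump_class q' (k + 2) x"
      using x by (simp add: bump_class_def w_def e_def)
    finally have "((\<lambda>x. poly q x / w x ^ k * exp (- (1 / w x))) has_real_derivative
       bump_class q' (k + 2) x) (at x)" .
    moreover have "\<forall>\<^sub>F y in nhds x. y \<in> {0<..<1}"
      using x by (intro eventually_nhds_in_open) auto
    then have "\<forall>\<^sub>F y in nhds x. bump_class q k y = poly q y / w y ^ k * exp (- (1 / w y))"
      by eventually_elim (auto simp: bump_class_def w_def)
    ultimately show ?thesis by (subst DERIV_cong_ev[OF refl _ refl]) auto
  qed
  have outside: "(bump_class q k has_real_derivative bump_class q' (k + 2) x) (at x)" if x: "x \<le> 0 \<or> x \<ge> 1" for x
  proof -
    have z: "bump_class q' (k + 2) x = 0" using x by (auto simp: bump_class_def)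
    consider "x < 0 \<or> x > 1" | "x = 0" | "x = 1" using x by linarith
    then show ?thesis unfolding z
    proof cases
      case 1
      then have "\<forall>\<^sub>F y in nhds x. y \<in> {..<0} \<union> {1<..}"
        by (intro eventually_nhds_in_open) auto
      then have "\<forall>\<^sub>F y in nhds x. bump_class q k y = 0"
        by eventually_elim (auto simp: bump_class_def)
      then show "(bump_class q k has_real_derivative 0) (at x)"
        by (subst DERIV_cong_ev[OF refl _ refl]) auto
    next
      case 2
      obtain C where C: "\<And>x. \<bar>bump_class q k x\<bar> \<le> C * (x * (1 - x))\<^sup>2" using bump_class_bound by blast
      have C0: "C \<ge> 0" using order_trans[OF abs_ge_zero C[of "1/2"]] by (simp add: zero_le_mult_iff)
      show "(bump_class q k has_real_derivative 0) (at x)"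
      proof (rule has_deriv_zero_quadratic)
        show "bump_class q k x = 0" using x by (auto simp: bump_class_def)
        fix y assume "\<bar>y - x\<bar> < 1"
        \<comment> \<open>Within distance 1 of the endpoint, the factor that does not vanish there
          is at most 2 in absolute value; hence the constant 4.\<close>
        then have "(1 - y)\<^sup>2 \<le> 4" using 2 abs_le_square_iff[of "1 - y" 2] by auto
        then have "(y * (1 - y))\<^sup>2 \<le> y\<^sup>2 * 4" unfolding power_mult_distrib by (intro mult_left_mono) auto
        then show "\<bar>bump_class q k y\<bar> \<le> (C * 4) * (y - x)\<^sup>2"
          using order_trans[OF C[of y] mult_left_mono[OF _ C0, of _ "y\<^sup>2 * 4"]] 2 by (simp add: mult_ac)
      qed
    next
      case 3
      obtain C where C: "\<And>x. \<bar>bump_class q k x\<bar> \<le> C * (x * (1 - x))\<^sup>2" using bump_class_bound by blast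
      have C0: "C \<ge> 0" using order_trans[OF abs_ge_zero C[of "1/2"]] by (simp add: zero_le_mult_iff)
      show "(bump_class q k has_real_derivative 0) (at x)"
      proof (rule has_deriv_zero_quadratic)
        show "bump_class q k x = 0" using x by (auto simp: bump_class_def)
        fix y assume "\<bar>y - x\<bar> < 1"
        then have "y\<^sup>2 \<le> 4" using 3 abs_le_square_iff[of y 2] by auto
        then have "(y * (1 - y))\<^sup>2 \<le> 4 * (1 - y)\<^sup>2" unfolding power_mult_distrib by (intro mult_right_mono) auto
        then show "\<bar>bump_class q k y\<bar> \<le> (C * 4) * (y - x)\<^sup>2"
          using order_trans[OF C[of y] mult_left_mono[OF _ C0, of _ "4 * (1 - y)\<^sup>2"]] 3
          by (simp add: mult_ac power2_commute)
      qed
    qed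
  qed
  show ?thesis using inside outside by (metis linorder_not_less)
qed

lemma smooth_bump_class: "smooth (bump_class q k)"
  by (rule smooth_coinduct[where C = "{bump_class q k |q k. True}"]) (use bump_class_deriv in blast)+

text \<open>The normalised antiderivative of the bump exp(-1/(x(1 - x))). Differences of rescaled
  copies of S approximate indicators of intervals, and rescaled copies of s approximate point
  masses.\<close>

lemma smooth_step_exists:
  obtains S s :: "real \<Rightarrow> real"
  where "smooth S" "smooth s" "\<And>x. (S has_real_derivative s x) (at x)"
    "\<And>x. 0 \<le> s x" "\<And>x. x \<le> 0 \<or> 1 \<le> x \<Longrightarrow> s x = 0"
    "\<And>x. x \<le> 0 \<Longrightarrow> S x = 0" "\<And>x. 1 \<le> x \<Longrightarrow> S x = 1" "\<And>x. 0 \<le> S x" "\<And>x. S x \<le> 1"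
proof -
  define s0 where "s0 = bump_class 1 0"
  have s0: "smooth s0" "\<And>x. 0 \<le> s0 x" "\<And>x. x \<le> 0 \<or> 1 \<le> x \<Longrightarrow> s0 x = 0"
    "\<And>x. 0 < x \<Longrightarrow> x < 1 \<Longrightarrow> 0 < s0 x"
    by (auto simp: s0_def smooth_bump_class) (auto simp: bump_class_def)
  \<comment> \<open>The lower limit -1 rather than 0 gives a two-sided derivative at 0; the bump
    vanishes on the negative axis, so the value is unaffected.\<close>
  define S0 where "S0 = (\<lambda>x. integral {-1..x} s0)"
  have dS0: "(S0 has_real_derivative s0 x) (at x)" if "x > -1" for x
  proof -
    have "(S0 has_real_derivative s0 x) (at x within {-1..x+1})"
      unfolding S0_def by (rule integral_has_real_derivative) (use that s0(1) smooth_continuous_on in auto)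
    then show ?thesis using that by (subst (asm) at_within_Icc_at) auto
  qed
  define S1 where "S1 = (\<lambda>x. if x \<le> 0 then 0 else S0 x)"
  have S0_0: "S0 x = 0" if "x \<le> 0" for x
  proof -
    have "integral {-1..x} s0 = integral {-1..x} (\<lambda>x. 0)"
      by (rule integral_cong) (use that s0(3) in auto)
    then show ?thesis by (simp add: S0_def)
  qed
  have dS1: "(S1 has_real_derivative s0 x) (at x)" for x
  proof (cases "x > -1")
    case True
    have "S1 = S0" using S0_0 by (auto simp: S1_def)
    then show ?thesis using dS0[OF True] by simp
  next
    case False
    then have "\<forall>\<^sub>F y in nhds x. y \<in> {..<0}"
      by (intro eventually_nhds_in_open) auto
    then have "\<forall>\<^sub>F y in nhds x. S1 y = 0"
      by eventually_elim (auto simp: S1_def)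
    then show ?thesis using False s0(3)[of x] by (subst DERIV_cong_ev[OF refl _ refl]) auto
  qed
  have mono: "S1 x \<le> S1 y" if "x \<le> y" for x y
    by (rule DERIV_nonneg_imp_nondecreasing[OF that]) (use dS1 s0(2) in blast)
  have pos: "S1 1 > 0"
  proof -
    have "continuous_on {0..1} S1"
      by (intro continuous_at_imp_continuous_on ballI DERIV_isCont[OF dS1])
    then have "S1 0 < S1 1"
      using DERIV_pos_imp_increasing_open[of 0 1 S1] dS1 s0(4) zero_less_one by metis
    then show ?thesis by (simp add: S1_def)
  qed
  have const: "S1 x = S1 1" if "1 \<le> x" for x
  proof (cases "x = 1")
    case False
    then have "1 < x" using that by simp
    have "continuous_on {1..x} S1"
      by (intro continuous_at_imp_continuous_on ballI DERIV_isCont[OF dS1])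
    moreover have "(S1 has_real_derivative 0) (at y)" if "1 < y" for y
      using dS1[of y] s0(3)[of y] that by simp
    ultimately show ?thesis
      using \<open>1 < x\<close> DERIV_isconst_end[of 1 x S1] by blast
  qed simp
  have S1_0: "S1 x = 0" if "x \<le> 0" for x using that by (simp add: S1_def)
  have S1_ge: "0 \<le> S1 x" for x using mono[of 0 x] S1_0[of x] S1_0[of 0] by (cases "x \<le> 0") auto
  have S1_le: "S1 x \<le> S1 1" for x using mono[of x 1] const[of x] by (cases "x \<le> 1") auto
  define s where "s = (\<lambda>x. s0 x / S1 1)"
  define S where "S = (\<lambda>x. S1 x / S1 1)"
  have ds: "(S has_real_derivative s x) (at x)" for x
    unfolding S_def s_def by (intro DERIV_cdivide dS1)
  have sm: "smooth s"
    using smooth_affine_diff[OF s0(1) s0(1), of "1 / S1 1" 1 0 0 1 0] by (simp add: s_def)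
  show ?thesis
  proof (rule that[OF smooth_antideriv[OF ds sm] sm ds])
    show "s x = 0" if "x \<le> 0 \<or> 1 \<le> x" for x using s0(3)[OF that] by (simp add: s_def)
    show "S x = 1" if "1 \<le> x" for x using const[OF that] pos by (simp add: S_def)
  qed (use pos in \<open>simp_all add: s_def S_def s0(2) S1_0 S1_ge S1_le\<close>)
qed

subsection \<open>Weak derivatives on an interval\<close>

lemma finite_measure_lebesgue_Ioo: "finite_measure (lebesgue_on {a<..<b::real})"
  by (intro finite_measure_lebesgue_on) (simp add: fmeasurableI_null_sets)

lemma borel_measurable_ident_lebesgue_on: "(\<lambda>x::real. x) \<in> borel_measurable (lebesgue_on S)"
  using id_borel_measurable_lebesgue_on[of S] by (simp add: id_def)

lemma borel_measurable_imp_lebesgue_on: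
  fixes f :: "real \<Rightarrow> real"
  assumes "f \<in> borel_measurable borel"
  shows "f \<in> borel_measurable (lebesgue_on S)"
  using measurable_compose[OF borel_measurable_ident_lebesgue_on assms] by simp

lemma integral_lebesgue_Ioo_continuous:
  fixes f :: "real \<Rightarrow> real"
  assumes "continuous_on {a..b} f"
  shows "integrable (lebesgue_on {a<..<b}) f" "(\<integral>x. f x \<partial>lebesgue_on {a<..<b}) = integral {a..b} f"
proof -
  have "integrable (lebesgue_on {a..b}) f" using assms by (rule continuous_imp_integrable_real)
  then show i: "integrable (lebesgue_on {a<..<b}) f"
    using absolutely_integrable_on_Icc_iff_Ioo[where f = f]
    by (simp add: integrable_restrict_space set_integrable_def)
  show "(\<integral>x. f x \<partial>lebesgue_on {a<..<b}) = integral {a..b} f"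
    using lebesgue_integral_eq_integral[OF i] integral_open_interval_real[of a b f] by simp
qed

text \<open>The sets over which f integrates to zero form a Dynkin system containing the
  intersection-stable half-open intervals, hence all Borel sets; a density with zero integral over
  each of them vanishes.\<close>

lemma AE_zero_if_integral_Ioc_zero:
  fixes f :: "real \<Rightarrow> real"
  assumes f: "integrable lebesgue f"
    and zero: "\<And>c d. c < d \<Longrightarrow> (\<integral>x. indicator {c<..d} x * f x \<partial>lebesgue) = 0"
  shows "AE x in lebesgue. f x = 0"
proof -
  define P where "P = (\<lambda>A::real set. (\<integral>x. indicator A x * f x \<partial>lebesgue) = 0)"
  have ind: "integrable lebesgue (\<lambda>x. indicator A x * f x)" if "A \<in> sets lebesgue" for A
    using integrable_mult_indicator[OF that f] by simp
  \<comment> \<open>Closure under complements requires the integral over the whole line, obtained by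
    exhausting it with bounded intervals.\<close>
  have total: "(\<integral>x. f x \<partial>lebesgue) = 0"
  proof (rule LIMSEQ_unique)
    show "(\<lambda>n. \<integral>x. indicator {-real (Suc n)<..real (Suc n)} x * f x \<partial>lebesgue) \<longlonglongrightarrow> (\<integral>x. f x \<partial>lebesgue)"
    proof (rule integral_dominated_convergence)
      show "integrable lebesgue (\<lambda>x. norm (f x))" using f by simp
      show "AE x in lebesgue. norm (indicator {-real (Suc n)<..real (Suc n)} x * f x) \<le> norm (f x)" for n
        by (simp add: indicator_def)
      show "AE x in lebesgue. (\<lambda>n. indicator {-real (Suc n)<..real (Suc n)} x * f x) \<longlonglongrightarrow> f x"
      proof (rule AE_I2)
        fix x
        have "\<forall>\<^sub>F n in sequentially. indicator {-real (Suc n)<..real (Suc n)} x * f x = f x"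
        proof (rule eventually_sequentiallyI)
          fix n assume "nat \<lceil>\<bar>x\<bar>\<rceil> \<le> n"
          then have "\<bar>x\<bar> \<le> real n" by linarith
          then show "indicator {-real (Suc n)<..real (Suc n)} x * f x = f x" by (auto simp: indicator_def)
        qed
        then show "(\<lambda>n. indicator {-real (Suc n)<..real (Suc n)} x * f x) \<longlonglongrightarrow> f x"
          by (rule tendsto_eventually)
      qed
    next
      show "(\<lambda>x. indicator {-real (Suc n)<..real (Suc n)} x * f x) \<in> borel_measurable lebesgue" for n
        by (intro borel_measurable_integrable ind) simp
    qed (use f in \<open>auto intro: borel_measurable_integrable simp: indicator_def\<close>)
    show "(\<lambda>n. \<integral>x. indicator {-real (Suc n)<..real (Suc n)} x * f x \<partial>lebesgue) \<longlonglongrightarrow> 0"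
      using zero by simp
  qed
  have P: "P A" if "A \<in> sets borel" for A
  proof -
    have "A \<in> sigma_sets UNIV (range (\<lambda>(c, d). {c <.. d::real}))"
      using that by (subst (asm) borel_sigma_sets_Ioc) simp
    note mem = this
    have Is: "Int_stable (range (\<lambda>(c, d). {c <.. d::real}))"
    proof (rule Int_stableI)
      fix X Y assume "X \<in> range (\<lambda>(c, d). {c <.. d::real})" "Y \<in> range (\<lambda>(c, d). {c <.. d::real})"
      then obtain c d c' d' where "X = {c<..d}" "Y = {c'<..d'}" by auto
      then have "X \<inter> Y = (\<lambda>(c, d). {c <.. d}) (max c c', min d d')" by auto
      then show "X \<inter> Y \<in> range (\<lambda>(c, d). {c <.. d::real})" by blast
    qed
    have cl: "range (\<lambda>(c, d). {c <.. d::real}) \<subseteq> Pow UNIV" by simp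
    from Is cl mem show ?thesis
    proof (induction rule: sigma_sets_induct_disjoint)
      case (basic A)
      then obtain c d where "A = {c<..d}" by auto
      then show ?case using zero[of c d] by (cases "c < d") (auto simp: P_def)
    next
      case empty
      then show ?case by (simp add: P_def)
    next
      case (compl A)
      then have "A \<in> sets borel" by (subst borel_sigma_sets_Ioc) simp
      then have A: "A \<in> sets lebesgue" by simp
      have "(\<integral>x. indicator (UNIV - A) x * f x \<partial>lebesgue) = (\<integral>x. f x - indicator A x * f x \<partial>lebesgue)"
        by (intro Bochner_Integration.integral_cong) (auto simp: indicator_def)
      also have "\<dots> = 0" using f ind[OF A] compl(2) total by (simp add: P_def)
      finally show ?case by (simp add: P_def)
    next
      case (union A)
      then have "A i \<in> sets borel" for i by (subst borel_sigma_sets_Ioc) auto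
      then have A: "A i \<in> sets lebesgue" for i by simp
      then have "set_integrable lebesgue (\<Union>i. A i) f"
        using ind[of "\<Union>i. A i"] by (auto simp: set_integrable_def)
      then have "(LINT x:(\<Union>i. A i)|lebesgue. f x) = (\<Sum>i. (LINT x:(A i)|lebesgue. f x))"
        by (intro lebesgue_integral_countable_add A) (use union(1) in \<open>auto simp: disjoint_family_on_def\<close>)
      then show ?case using union(3) by (simp add: P_def set_lebesgue_integral_def)
    qed
  qed
  \<comment> \<open>The density criterion is applied over \<open>lborel\<close>, so the Lebesgue
    measurable f is replaced by a Borel function equal to it almost everywhere.\<close>
  obtain f' where f': "f' \<in> borel_measurable lborel" "AE x in lborel. f x = f' x"
    using completion_ex_borel_measurable_real[OF borel_measurable_integrable[OF f]] by blast
  have ae: "AE x in lebesgue. f x = f' x" using f'(2) by (rule AE_completion)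
  have f'l: "f' \<in> borel_measurable lebesgue" using f'(1) by (rule measurable_completion)
  have "integrable lebesgue f'"
    using integrable_cong_AE[OF borel_measurable_integrable[OF f] f'l ae] f by simp
  then have i: "integrable lborel f'" using integrable_completion[OF f'(1)] by simp
  have "AE x in lborel. f' x = 0"
  proof (rule sigma_finite_measure.density_zero[OF sigma_finite_lborel i])
    fix A assume A: "A \<in> sets (lborel :: real measure)"
    have "set_lebesgue_integral lborel A f' = (\<integral>x. indicator A x * f' x \<partial>lebesgue)"
      unfolding set_lebesgue_integral_def using A f'(1) by (subst integral_completion) auto
    also have "\<dots> = (\<integral>x. indicator A x * f x \<partial>lebesgue)"
      using ae A f'l borel_measurable_integrable[OF f]
      by (intro integral_cong_AE borel_measurable_times borel_measurable_indicator) auto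
    finally show "set_lebesgue_integral lborel A f' = 0" using P[of A] A by (simp add: P_def)
  qed
  then have "AE x in lebesgue. f' x = 0" by (rule AE_completion)
  with ae show ?thesis by eventually_elim simp
qed

section \<open>Testing weak derivatives with smoothed indicators\<close>

lemma test_functionsD:
  assumes "\<phi> \<in> test_functions a b"
  shows "smooth \<phi>" "\<And>x. x \<notin> {a<..<b} \<Longrightarrow> \<phi> x = 0"
  using assms closure_subset[of "{x. \<phi> x \<noteq> 0}"] by (auto simp: test_functions_def smooth_def)

text \<open>The kernels are the derivatives of \<open>S (n * (x - c))\<close>: nonnegative,
  supported in [c, c + 1/n], and of mass one as soon as 1/n < b - c.\<close>

lemma mollifier_limit:
  fixes v s :: "real \<Rightarrow> real"
  assumes v: "continuous_on {a..b} v" and c: "a < c" "c < b"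
    and S: "\<And>x. (S has_real_derivative s x) (at x)" "\<And>x. x \<le> 0 \<Longrightarrow> S x = 0" "\<And>x. 1 \<le> x \<Longrightarrow> S x = 1"
    and s: "continuous_on UNIV s" "\<And>x. 0 \<le> s x" "\<And>x. x \<le> 0 \<or> 1 \<le> x \<Longrightarrow> s x = 0"
  shows "(\<lambda>n. \<integral>x. v x * (real n * s (real n * (x - c))) \<partial>lebesgue_on {a<..<b}) \<longlonglongrightarrow> v c"
proof (rule LIMSEQ_I)
  fix r :: real assume "r > 0"
  define \<psi> where "\<psi> = (\<lambda>n x. real n * s (real n * (x - c)))"
  have cont: "continuous_on X (\<psi> n)" for X n
    unfolding \<psi>_def by (intro continuous_intros continuous_on_compose2[OF s(1)]) auto
  obtain \<delta> where "\<delta> > 0" and \<delta>: "\<And>x. x \<in> {a..b} \<Longrightarrow> \<bar>x - c\<bar> < \<delta> \<Longrightarrow> \<bar>v x - v c\<bar> < r / 2"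
    using v c \<open>r > 0\<close> unfolding continuous_on_iff dist_real_def
    by (metis atLeastAtMost_iff half_gt_zero less_eq_real_def)
  \<comment> \<open>The bound by \<delta> puts the support where v is within r/2 of
    \<open>v c\<close>; the bound by b - c puts it inside the interval, so that no mass is
    lost.\<close>
  obtain N where N: "inverse (real (Suc N)) < min \<delta> (b - c)"
    using reals_Archimedean[of "min \<delta> (b - c)"] \<open>\<delta> > 0\<close> c by auto
  show "\<exists>no. \<forall>n\<ge>no. norm ((\<integral>x. v x * (real n * s (real n * (x - c))) \<partial>lebesgue_on {a<..<b}) - v c) < r"
  proof (intro exI allI impI)
    fix n assume "Suc N \<le> n"
    then have n: "n > 0" "inverse (real n) < \<delta>" "inverse (real n) < b - c"
    proof -
      have "inverse (real n) \<le> inverse (real (Suc N))"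
        using \<open>Suc N \<le> n\<close> by (intro le_imp_inverse_le) auto
      then show "inverse (real n) < \<delta>" "inverse (real n) < b - c" using N by auto
    qed (use \<open>Suc N \<le> n\<close> in simp)
    have small: "real n * (x - c) \<ge> 1" if "x \<ge> c + inverse (real n)" for x
    proof -
      have "real n * inverse (real n) \<le> real n * (x - c)" using that by (intro mult_left_mono) auto
      then show ?thesis using n(1) by simp
    qed
    have "(\<psi> n has_integral (S (real n * (b - c)) - S (real n * (a - c)))) {a..b}"
    proof (rule fundamental_theorem_of_calculus)
      fix x
      have "((\<lambda>x. S (real n * (x - c))) has_real_derivative s (real n * (x - c)) * real n) (at x)"
        by (intro DERIV_chain2[OF S(1)]) (auto intro!: derivative_eq_intros)
      then show "((\<lambda>x. S (real n * (x - c))) has_vector_derivative \<psi> n x) (at x within {a..b})"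
        unfolding \<psi>_def
        by (simp add: has_real_derivative_iff_has_vector_derivative mult.commute has_vector_derivative_at_within)
    qed (use c in auto)
    moreover have "S (real n * (b - c)) = 1" using n(3) by (intro S(3) small) simp
    moreover have "S (real n * (a - c)) = 0" using c by (intro S(2)) (simp add: mult_nonneg_nonpos)
    ultimately have \<psi>1: "(\<psi> n has_integral 1) {a..b}" by simp
    have i: "(\<lambda>x. v x * \<psi> n x) integrable_on {a..b}" "(\<lambda>x. v c * \<psi> n x) integrable_on {a..b}"
      by (intro integrable_continuous_real continuous_intros v cont)+
    have "integral {a..b} (\<lambda>x. v x * \<psi> n x) - v c
        = integral {a..b} (\<lambda>x. v x * \<psi> n x) - integral {a..b} (\<lambda>x. v c * \<psi> n x)"
      using \<psi>1 by (simp add: integral_unique)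
    also have "\<dots> = integral {a..b} (\<lambda>x. v x * \<psi> n x - v c * \<psi> n x)"
      using i by (simp add: Henstock_Kurzweil_Integration.integral_diff)
    also have "norm \<dots> \<le> integral {a..b} (\<lambda>x. r / 2 * \<psi> n x)"
    proof (rule Henstock_Kurzweil_Integration.integral_norm_bound_integral)
      fix x assume x: "x \<in> {a..b}"
      have nn: "0 \<le> \<psi> n x" unfolding \<psi>_def using s(2) by simp
      have "\<bar>v x - v c\<bar> * \<psi> n x \<le> r / 2 * \<psi> n x"
      proof (cases "\<bar>x - c\<bar> < \<delta>")
        case True
        then show ?thesis using \<delta>[OF x] nn by (intro mult_right_mono) auto
      next
        case False
        have "\<psi> n x = 0"
        proof (cases "x \<le> c")
          case True
          then show ?thesis unfolding \<psi>_def by (subst s(3)) (auto simp: mult_nonneg_nonpos)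
        next
          case x: False
          then have "1 \<le> real n * (x - c)" using False n(2) by (intro small) auto
          then show ?thesis unfolding \<psi>_def using s(3) by simp
        qed
        then show ?thesis by simp
      qed
      moreover have "norm (v x * \<psi> n x - v c * \<psi> n x) = \<bar>v x - v c\<bar> * \<psi> n x"
        using nn by (simp add: abs_mult flip: left_diff_distrib)
      ultimately show "norm (v x * \<psi> n x - v c * \<psi> n x) \<le> r / 2 * \<psi> n x" by simp
    qed (use i in \<open>auto intro!: integrable_continuous_real continuous_intros cont v integrable_diff\<close>)
    also have "\<dots> = r / 2" using \<psi>1 by (simp add: integral_unique)
    finally have "norm (integral {a..b} (\<lambda>x. v x * \<psi> n x) - v c) \<le> r / 2" .
    moreover have "(\<integral>x. v x * \<psi> n x \<partial>lebesgue_on {a<..<b}) = integral {a..b} (\<lambda>x. v x * \<psi> n x)"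
      by (intro integral_lebesgue_Ioo_continuous continuous_intros v cont)
    ultimately show "norm ((\<integral>x. v x * (real n * s (real n * (x - c))) \<partial>lebesgue_on {a<..<b}) - v c) < r"
      using \<open>r > 0\<close> by (simp add: \<psi>_def)
  qed
qed

lemma locally_integrable_Icc:
  assumes "locally_integrable a b g" "a < c" "d < b"
  shows "integrable (lebesgue_on {a<..<b}) (\<lambda>x. indicator {c..d} x * g x)"
proof -
  have "set_integrable lebesgue {c..d} g"
    using assms(1)[unfolded locally_integrable_def, rule_format, of "{c..d}"] assms(2,3)
    by (simp add: subset_eq)
  then have "integrable lebesgue (\<lambda>x. indicator {c..d} x * g x)" by (simp add: set_integrable_def)
  moreover have "(\<lambda>x. indicator {a<..<b} x * (indicator {c..d} x * g x)) = (\<lambda>x. indicator {c..d} x * g x)"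
    using assms by (force simp: indicator_def)
  ultimately show ?thesis by (simp add: integrable_restrict_space)
qed

lemma locally_integrable_mult_bounded:
  fixes g \<phi> :: "real \<Rightarrow> real"
  assumes "locally_integrable a b g" "a < c" "d < b"
    and "\<phi> \<in> borel_measurable borel" "\<And>x. x \<notin> {c..d} \<Longrightarrow> \<phi> x = 0" "\<And>x. \<bar>\<phi> x\<bar> \<le> B"
  shows "integrable (lebesgue_on {a<..<b}) (\<lambda>x. g x * \<phi> x)"
proof -
  have eq: "(\<lambda>x. (indicator {c..d} x * g x) * \<phi> x) = (\<lambda>x. g x * \<phi> x)"
    using assms(5) by (force simp: indicator_def)
  have i: "integrable (lebesgue_on {a<..<b}) (\<lambda>x. indicator {c..d} x * g x)"
    using locally_integrable_Icc assms(1-3) .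
  have "integrable (lebesgue_on {a<..<b}) (\<lambda>x. (indicator {c..d} x * g x) * \<phi> x)"
  proof (rule Bochner_Integration.integrable_bound)
    show "integrable (lebesgue_on {a<..<b}) (\<lambda>x. B * norm (indicator {c..d} x * g x))"
      using i by (intro integrable_mult_right integrable_norm)
    show "AE x in lebesgue_on {a<..<b}. norm (indicator {c..d} x * g x * \<phi> x)
        \<le> norm (B * norm (indicator {c..d} x * g x))"
    proof (rule AE_I2)
      fix x
      have "norm (indicator {c..d} x * g x) * \<bar>\<phi> x\<bar> \<le> norm (indicator {c..d} x * g x) * \<bar>B\<bar>"
        using assms(6)[of x] by (intro mult_left_mono) auto
      then show "norm (indicator {c..d} x * g x * \<phi> x) \<le> norm (B * norm (indicator {c..d} x * g x))"
        by (simp add: abs_mult mult_ac)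
    qed
  qed (intro borel_measurable_times borel_measurable_imp_lebesgue_on[OF assms(4)]
        borel_measurable_integrable[OF i])
  then show ?thesis unfolding eq .
qed

text \<open>Test with smoothed indicators of the interval from c to d. Their derivatives are a
  kernel at c minus a kernel at d, so one side of the weak identity tends to the integral of g and
  the other to the increment of v.\<close>

lemma weak_deriv_integral_Ioc:
  assumes w: "has_weak_deriv a b u g" and uv: "AE x in lebesgue_on {a<..<b}. u x = v x"
    and v: "continuous_on {a..b} v" and cd: "a < c" "c < d" "d < b"
  shows "(\<integral>x. indicator {c<..d} x * g x \<partial>lebesgue_on {a<..<b}) = v d - v c"
proof -
  let ?M = "lebesgue_on {a<..<b}"
  obtain S s :: "real \<Rightarrow> real" where
    S: "smooth S" "smooth s" "\<And>x. (S has_real_derivative s x) (at x)"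
    and s: "\<And>x. 0 \<le> s x" "\<And>x. x \<le> 0 \<or> 1 \<le> x \<Longrightarrow> s x = 0"
    and S01: "\<And>x. x \<le> 0 \<Longrightarrow> S x = 0" "\<And>x. 1 \<le> x \<Longrightarrow> S x = 1" "\<And>x. 0 \<le> S x" "\<And>x. S x \<le> 1"
    using smooth_step_exists by metis
  \<comment> \<open>All test functions are to be supported in the fixed compact interval [c, e]; the
    index shift by \<open>Suc N\<close> makes the transition at d end before e.\<close>
  define e where "e = (d + b) / 2"
  have e: "d < e" "e < b" using cd by (auto simp: e_def)
  obtain N where N: "inverse (real (Suc N)) < e - d" using reals_Archimedean[of "e - d"] e by auto
  define \<phi> where "\<phi> = (\<lambda>n x. S (real (n + Suc N) * (x - c)) - S (real (n + Suc N) * (x - d)))"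
  define \<psi> where "\<psi> = (\<lambda>t n x. real n * s (real n * (x - t)))"
  have inv: "inverse (real (n + Suc N)) < e - d" for n
  proof -
    have "inverse (real (n + Suc N)) \<le> inverse (real (Suc N))" by (intro le_imp_inverse_le) auto
    from order.strict_trans1[OF this N] show ?thesis .
  qed
  have big: "1 \<le> real (n + Suc N) * (x - t)" if "x \<ge> t + (e - d)" for x t n
  proof -
    have "real (n + Suc N) * inverse (real (n + Suc N)) \<le> real (n + Suc N) * (x - t)"
      using that inv[of n] by (intro mult_left_mono) auto
    then show ?thesis by simp
  qed
  have supp: "\<phi> n x = 0" if "x \<notin> {c..e}" for n x
  proof (cases "x < c")
    case True
    then show ?thesis unfolding \<phi>_def using cd
      by (subst (1 2) S01(1)) (auto simp: mult_nonneg_nonpos)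
  next
    case False
    then have "x > e" using that by auto
    then show ?thesis unfolding \<phi>_def using cd big[of c x n] big[of d x n]
      by (subst (1 2) S01(2)) auto
  qed
  have smooth_\<phi>: "smooth (\<phi> n)" for n
    using smooth_affine_diff[OF S(1) S(1), of 1 "real (n + Suc N)" c 1 "real (n + Suc N)" d] by (simp add: \<phi>_def)
  have test: "\<phi> n \<in> test_functions a b" for n
  proof -
    have sub: "{x. \<phi> n x \<noteq> 0} \<subseteq> {c..e}" using supp by blast
    then have "closure {x. \<phi> n x \<noteq> 0} \<subseteq> {c..e}" by (rule closure_minimal) simp
    moreover have "compact (closure {x. \<phi> n x \<noteq> 0})"
      unfolding compact_closure
      by (rule bounded_subset[OF _ sub]) simp
    ultimately show ?thesis
      using smooth_\<phi> cd e by (auto simp: test_functions_def smooth_def)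
  qed
  have d\<phi>: "deriv (\<phi> n) x = \<psi> c (n + Suc N) x - \<psi> d (n + Suc N) x" for n x
  proof -
    have aff: "((\<lambda>x. real (n + Suc N) * (x - t)) has_real_derivative real (n + Suc N)) (at x)" for t
      by (auto intro!: derivative_eq_intros)
    have "(\<phi> n has_real_derivative s (real (n + Suc N) * (x - c)) * real (n + Suc N)
        - s (real (n + Suc N) * (x - d)) * real (n + Suc N)) (at x)"
      unfolding \<phi>_def by (intro DERIV_diff DERIV_chain2[OF S(3) aff])
    then show ?thesis by (simp add: DERIV_imp_deriv \<psi>_def mult.commute)
  qed
  have \<psi>_cont: "continuous_on X (\<psi> t n)" for X t n
    unfolding \<psi>_def by (intro continuous_intros continuous_on_compose2[OF smooth_continuous_on[OF S(2), of UNIV]]) auto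
  have li: "locally_integrable a b u" "locally_integrable a b g" using w by (auto simp: has_weak_deriv_def)
  have \<phi>_borel: "\<phi> n \<in> borel_measurable borel" for n
    by (intro borel_measurable_continuous_onI smooth_continuous_on smooth_\<phi>)
  have \<phi>_bound: "\<bar>\<phi> n x\<bar> \<le> 1" for n x
    using S01(3,4)[of "real (n + Suc N) * (x - c)"] S01(3,4)[of "real (n + Suc N) * (x - d)"]
    by (simp add: \<phi>_def abs_le_iff)
  have "(\<lambda>n. \<integral>x. g x * \<phi> n x \<partial>?M) \<longlonglongrightarrow> (\<integral>x. indicator {c<..d} x * g x \<partial>?M)"
  proof (rule integral_dominated_convergence)
    show "integrable ?M (\<lambda>x. norm (indicator {c..e} x * g x))"
      using cd e by (intro integrable_norm locally_integrable_Icc li)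
    have "(\<lambda>x. indicator {c<..d} x * g x) = (\<lambda>x. g x * indicator {c<..d} x)" by (auto simp: mult.commute)
    moreover have "integrable ?M (\<lambda>x. g x * indicator {c<..d} x)"
      by (rule locally_integrable_mult_bounded[OF li(2) cd(1), of d _ 1])
        (use cd in \<open>auto simp: indicator_def\<close>)
    ultimately show "(\<lambda>x. indicator {c<..d} x * g x) \<in> borel_measurable ?M"
      using borel_measurable_integrable by metis
    show "(\<lambda>x. g x * \<phi> n x) \<in> borel_measurable ?M" for n
      by (rule borel_measurable_integrable, rule locally_integrable_mult_bounded[OF li(2) cd(1) e(2) \<phi>_borel supp \<phi>_bound])
    show "AE x in ?M. norm (g x * \<phi> n x) \<le> norm (indicator {c..e} x * g x)" for n
    proof (rule AE_I2)
      fix x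
      show "norm (g x * \<phi> n x) \<le> norm (indicator {c..e} x * g x)"
        using supp[of x n] mult_left_mono[OF \<phi>_bound[of n x] abs_ge_zero[of "g x"]]
        by (cases "x \<in> {c..e}") (auto simp: abs_mult)
    qed
    show "AE x in ?M. (\<lambda>n. g x * \<phi> n x) \<longlonglongrightarrow> indicator {c<..d} x * g x"
    proof (rule AE_I2)
      fix x
      \<comment> \<open>At x = t the argument of S is 0, where S vanishes; hence the limiting
        indicator belongs to the interval open at c and closed at d.\<close>
      have lim: "(\<lambda>n. S (real (n + Suc N) * (x - t))) \<longlonglongrightarrow> (if t < x then 1 else 0)" for t
      proof (cases "t < x")
        case True
        obtain K where K: "inverse (real (Suc K)) < x - t" using reals_Archimedean[of "x - t"] True by auto
        have "S (real (n + Suc N) * (x - t)) = 1" if "n \<ge> Suc K" for n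
        proof (rule S01(2))
          have "real (Suc K) * inverse (real (Suc K)) \<le> real (n + Suc N) * (x - t)"
            using that K by (intro mult_mono) auto
          then show "1 \<le> real (n + Suc N) * (x - t)" by simp
        qed
        then show ?thesis using True
          by (intro tendsto_eventually eventually_sequentiallyI[of "Suc K"]) auto
      next
        case False
        then show ?thesis
          using S01(1)[of "real (n + Suc N) * (x - t)" for n]
          by (intro tendsto_eventually always_eventually) (auto simp: mult_nonneg_nonpos)
      qed
      have "(\<lambda>n. g x * \<phi> n x) \<longlonglongrightarrow> g x * ((if c < x then 1 else 0) - (if d < x then 1 else 0))"
        unfolding \<phi>_def by (intro tendsto_intros lim)
      also have "g x * ((if c < x then 1 else 0) - (if d < x then 1 else 0)) = indicator {c<..d} x * g x"
        using cd by (auto simp: indicator_def)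
      finally show "(\<lambda>n. g x * \<phi> n x) \<longlonglongrightarrow> indicator {c<..d} x * g x" .
    qed
  qed
  moreover have "(\<lambda>n. \<integral>x. g x * \<phi> n x \<partial>?M) \<longlonglongrightarrow> - (v c - v d)"
  proof -
    have eq: "(\<integral>x. g x * \<phi> n x \<partial>?M)
        = - ((\<integral>x. v x * \<psi> c (n + Suc N) x \<partial>?M) - (\<integral>x. v x * \<psi> d (n + Suc N) x \<partial>?M))" for n
    proof -
      have "(\<integral>x. g x * \<phi> n x \<partial>?M) = - (\<integral>x. u x * deriv (\<phi> n) x \<partial>?M)"
        using w test[of n] by (simp add: has_weak_deriv_def)
      \<comment> \<open>Only the continuous representative v has point values that the kernels can
        pick out.\<close>
      also have "(\<integral>x. u x * deriv (\<phi> n) x \<partial>?M) = (\<integral>x. v x * deriv (\<phi> n) x \<partial>?M)"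
      proof (rule integral_cong_AE)
        have cont: "continuous_on X (deriv (\<phi> n))" for X
          by (intro smooth_continuous_on smooth_deriv smooth_\<phi>)
        obtain B where B: "\<And>x. x \<in> {c..e} \<Longrightarrow> \<bar>deriv (\<phi> n) x\<bar> \<le> B"
          using compact_imp_bounded[OF compact_continuous_image[OF cont, of "{c..e}"]]
          unfolding bounded_iff by (metis compact_Icc image_eqI real_norm_def)
        have z: "deriv (\<phi> n) x = 0" if "x \<notin> {c..e}" for x
        proof -
          have "\<forall>\<^sub>F y in nhds x. y \<in> - {c..e}" using that by (intro eventually_nhds_in_open) auto
          then have "\<forall>\<^sub>F y in nhds x. \<phi> n y = 0" by eventually_elim (use supp in auto)
          then have "(\<phi> n has_real_derivative 0) (at x)"
            by (subst DERIV_cong_ev[OF refl _ refl]) auto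
          then show ?thesis by (rule DERIV_imp_deriv)
        qed
        have "\<bar>deriv (\<phi> n) x\<bar> \<le> \<bar>B\<bar>" for x using B[of x] z[of x] by (cases "x \<in> {c..e}") auto
        then show "(\<lambda>x. u x * deriv (\<phi> n) x) \<in> borel_measurable ?M"
          by (intro borel_measurable_integrable
              locally_integrable_mult_bounded[OF li(1) cd(1) e(2) borel_measurable_continuous_onI[OF cont] z])
        show "(\<lambda>x. v x * deriv (\<phi> n) x) \<in> borel_measurable ?M"
          by (intro borel_measurable_integrable integral_lebesgue_Ioo_continuous(1) continuous_intros v cont)
        show "AE x in ?M. u x * deriv (\<phi> n) x = v x * deriv (\<phi> n) x"
          using uv by eventually_elim simp
      qed
      also have "\<dots> = (\<integral>x. v x * \<psi> c (n + Suc N) x - v x * \<psi> d (n + Suc N) x \<partial>?M)"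
        by (simp add: d\<phi> right_diff_distrib)
      also have "\<dots> = (\<integral>x. v x * \<psi> c (n + Suc N) x \<partial>?M) - (\<integral>x. v x * \<psi> d (n + Suc N) x \<partial>?M)"
        by (intro Bochner_Integration.integral_diff integral_lebesgue_Ioo_continuous(1) continuous_intros v \<psi>_cont)
      finally show ?thesis .
    qed
    have "(\<lambda>n. \<integral>x. v x * \<psi> t n x \<partial>?M) \<longlonglongrightarrow> v t" if "a < t" "t < b" for t
      unfolding \<psi>_def
      using mollifier_limit[OF v that S(3) S01(1,2) smooth_continuous_on[OF S(2)] s] .
    from LIMSEQ_ignore_initial_segment[OF this, of _ "Suc N"]
    show ?thesis unfolding eq using cd by (intro tendsto_intros) auto
  qed
  ultimately have "(\<integral>x. indicator {c<..d} x * g x \<partial>?M) = - (v c - v d)"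
    by (rule LIMSEQ_unique)
  then show ?thesis by simp
qed

text \<open>Over every half-open interval compactly inside, both candidates integrate to the same
  increment of v. Being only locally integrable, they are compared on interior intervals first and
  then along a countable exhaustion.\<close>

lemma weak_deriv_unique_AE:
  assumes w: "has_weak_deriv a b u g" "has_weak_deriv a b u g'"
    and uv: "AE x in lebesgue_on {a<..<b}. u x = v x" and v: "continuous_on {a..b} v"
  shows "AE x in lebesgue_on {a<..<b}. g x = g' x"
proof -
  let ?M = "lebesgue_on {a<..<b}"
  have li: "locally_integrable a b g" "locally_integrable a b g'" using w by (auto simp: has_weak_deriv_def)
  have loc: "AE x in lebesgue. x \<in> {c<..d} \<longrightarrow> g x = g' x" if cd: "a < c" "d < b" for c d
  proof -
    \<comment> \<open>Cut off and extended by zero, the difference is integrable on the whole line,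
      as the vanishing criterion demands.\<close>
    define h where "h = (\<lambda>x. indicator {c<..d} x * (g x - g' x))"
    have i: "integrable ?M (\<lambda>x. f x * indicator {s<..t} x)" if "locally_integrable a b f" "c \<le> s" "t \<le> d" for f s t
      by (rule locally_integrable_mult_bounded[OF that(1) cd, of _ 1]) (use that in \<open>auto simp: indicator_def\<close>)
    have hM: "integrable ?M h"
      using Bochner_Integration.integrable_diff[OF i[OF li(1)] i[OF li(2)], of c d c d]
      by (simp add: h_def algebra_simps)
    moreover have h0: "(\<lambda>x. indicator {a<..<b} x * h x) = h"
      using cd by (force simp: h_def indicator_def)
    ultimately have hL: "integrable lebesgue h" by (simp add: integrable_restrict_space)
    have "AE x in lebesgue. h x = 0"
    proof (rule AE_zero_if_integral_Ioc_zero[OF hL])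
      fix p q :: real assume "p < q"
      define s t where "s = max c p" and "t = min d q"
      have "(\<integral>x. indicator {p<..q} x * h x \<partial>lebesgue) = (\<integral>x. indicator {a<..<b} x *\<^sub>R (indicator {p<..q} x * h x) \<partial>lebesgue)"
        using fun_cong[OF h0] by (intro Bochner_Integration.integral_cong) (auto simp: algebra_simps)
      also have "\<dots> = (\<integral>x. indicator {p<..q} x * h x \<partial>?M)"
        by (subst integral_restrict_space) auto
      also have "\<dots> = (\<integral>x. g x * indicator {s<..t} x - g' x * indicator {s<..t} x \<partial>?M)"
        by (intro Bochner_Integration.integral_cong) (auto simp: h_def indicator_def s_def t_def)
      also have "(\<integral>x. g x * indicator {s<..t} x - g' x * indicator {s<..t} x \<partial>?M)
          = (\<integral>x. g x * indicator {s<..t} x \<partial>?M) - (\<integral>x. g' x * indicator {s<..t} x \<partial>?M)"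
        by (intro Bochner_Integration.integral_diff i li) (auto simp: s_def t_def)
      also have "\<dots> = 0"
      proof (cases "s < t")
        case True
        then show ?thesis
          using weak_deriv_integral_Ioc[OF w(1) uv v, of s t] weak_deriv_integral_Ioc[OF w(2) uv v, of s t] cd
          by (simp add: s_def t_def mult.commute)
      qed simp
      finally show "(\<integral>x. indicator {p<..q} x * h x \<partial>lebesgue) = 0" .
    qed
    then show ?thesis by eventually_elim (auto simp: h_def indicator_def split: if_splits)
  qed
  have "AE x in lebesgue. \<forall>n::nat. x \<in> {a + inverse (real (Suc n))<..b - inverse (real (Suc n))} \<longrightarrow> g x = g' x"
    unfolding AE_all_countable by (intro allI loc) auto
  then have "AE x in lebesgue. x \<in> {a<..<b} \<longrightarrow> g x = g' x"
  proof eventually_elim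
    case (elim x)
    show ?case
    proof
      assume x: "x \<in> {a<..<b}"
      obtain n where "inverse (real (Suc n)) < min (x - a) (b - x)"
        using reals_Archimedean[of "min (x - a) (b - x)"] x by auto
      then show "g x = g' x" using elim[rule_format, of n] by auto
    qed
  qed
  then show ?thesis by (subst AE_restrict_space_iff) auto
qed

text \<open>The identity for interior increments is moved to the endpoints: dominated convergence
  for the integral of g, continuity up to the boundary for v. This is how boundary values enter the
  energy argument.\<close>

lemma weak_deriv_integral:
  assumes ab: "a < b" and w: "has_weak_deriv a b u g" and g: "integrable (lebesgue_on {a<..<b}) g"
    and uv: "AE x in lebesgue_on {a<..<b}. u x = v x" and v: "continuous_on {a..b} v"
  shows "(\<integral>x. g x \<partial>lebesgue_on {a<..<b}) = v b - v a"
proof -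
  let ?M = "lebesgue_on {a<..<b}"
  \<comment> \<open>The factor 1/3 keeps \<open>a + h n\<close> below \<open>b - h n\<close> for
    every n, including n = 0.\<close>
  define h where "h = (\<lambda>n. (b - a) * inverse (real (Suc n)) / 3)"
  have h0: "h \<longlonglongrightarrow> 0" unfolding h_def by (rule tendsto_eq_intros LIMSEQ_inverse_real_of_nat refl | simp)+
  have hpos: "0 < h n" "h n \<le> (b - a) / 3" for n
  proof -
    have "inverse (real (Suc n)) \<le> 1" by (simp add: inverse_eq_divide)
    from mult_left_mono[OF this, of "b - a"] show "h n \<le> (b - a) / 3" using ab by (simp add: h_def)
  qed (use ab in \<open>simp add: h_def\<close>)
  have hn: "a < a + h n" "a + h n < b - h n" "b - h n < b" for n
    using hpos[of n] ab by (auto simp: field_simps)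
  have hn': "a \<le> b - h n" "a + h n \<le> b" for n using hn[of n] by auto
  have "(\<lambda>n. \<integral>x. indicator {a + h n<..b - h n} x * g x \<partial>?M) \<longlonglongrightarrow> (\<integral>x. g x \<partial>?M)"
  proof (rule integral_dominated_convergence)
    show "integrable ?M (\<lambda>x. norm (g x))" using g by simp
    show "g \<in> borel_measurable ?M" using g by simp
    show "(\<lambda>x. indicator {a + h n<..b - h n} x * g x) \<in> borel_measurable ?M" for n
      by (intro borel_measurable_times borel_measurable_imp_lebesgue_on borel_measurable_integrable[OF g]) auto
    show "AE x in ?M. norm (indicator {a + h n<..b - h n} x * g x) \<le> norm (g x)" for n
      by (simp add: indicator_def)
    show "AE x in ?M. (\<lambda>n. indicator {a + h n<..b - h n} x * g x) \<longlonglongrightarrow> g x"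
    proof (rule AE_I2)
      fix x assume "x \<in> space ?M"
      then have x: "a < x" "x < b" by auto
      have "\<forall>\<^sub>F n in sequentially. h n < min (x - a) (b - x)"
        using x by (intro order_tendstoD(2)[OF h0]) auto
      then have "\<forall>\<^sub>F n in sequentially. indicator {a + h n<..b - h n} x * g x = g x"
        by eventually_elim (auto simp: indicator_def)
      then show "(\<lambda>n. indicator {a + h n<..b - h n} x * g x) \<longlonglongrightarrow> g x" by (rule tendsto_eventually)
    qed
  qed
  moreover have "(\<lambda>n. v (b - h n) - v (a + h n)) \<longlonglongrightarrow> v b - v a"
  proof (intro tendsto_diff)
    show "(\<lambda>n. v (b - h n)) \<longlonglongrightarrow> v b"
      by (rule continuous_on_tendsto_compose[OF v]) (use hn' hpos(1) ab h0 in \<open>auto intro!: tendsto_eq_intros less_imp_le always_eventually\<close>)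
    show "(\<lambda>n. v (a + h n)) \<longlonglongrightarrow> v a"
      by (rule continuous_on_tendsto_compose[OF v]) (use hn' hpos(1) ab h0 in \<open>auto intro!: tendsto_eq_intros less_imp_le always_eventually\<close>)
  qed
  moreover have "(\<integral>x. indicator {a + h n<..b - h n} x * g x \<partial>?M) = v (b - h n) - v (a + h n)" for n
    by (rule weak_deriv_integral_Ioc[OF w uv v hn])
  ultimately show ?thesis using LIMSEQ_unique by simp
qed

section \<open>Antiderivatives as weakly differentiable functions\<close>

lemma indefinite_integral_lebesgue:
  fixes g :: "real \<Rightarrow> real" and A :: real
  assumes ab: "a < b" and g: "integrable (lebesgue_on {a<..<b}) g"
  defines "u \<equiv> \<lambda>x. A + (\<integral>t. (if t < x then g t else 0) \<partial>lebesgue_on {a<..<b})"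
  shows "continuous_on {a..b} u" "u a = A" "u b = A + (\<integral>t. g t \<partial>lebesgue_on {a<..<b})"
proof -
  let ?M = "lebesgue_on {a<..<b}"
  \<comment> \<open>The cutoff over one fixed measure is the form suited to Fubini; for continuity
    it is rewritten as an integral over [a, x].\<close>
  have eq: "u x = A + integral {a..x} g" if x: "x \<in> {a..b}" for x
  proof -
    have "(\<integral>t. (if t < x then g t else 0) \<partial>?M) = (\<integral>t. indicator {a<..<b} t *\<^sub>R (if t < x then g t else 0) \<partial>lebesgue)"
      by (subst integral_restrict_space) auto
    also have "\<dots> = (\<integral>t. indicator {a<..<x} t *\<^sub>R g t \<partial>lebesgue)"
      using x by (intro Bochner_Integration.integral_cong) (auto simp: indicator_def)
    also have "\<dots> = (\<integral>t. g t \<partial>lebesgue_on {a<..<x})"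
      by (subst integral_restrict_space) auto
    also have "\<dots> = integral {a<..<x} g"
    proof (rule lebesgue_integral_eq_integral)
      have "set_integrable lebesgue {a<..<b} g"
        using g by (simp add: integrable_restrict_space set_integrable_def)
      then have "set_integrable lebesgue {a<..<x} g"
        by (rule set_integrable_subset) (use x in auto)
      then show "integrable (lebesgue_on {a<..<x}) g"
        by (simp add: integrable_restrict_space set_integrable_def)
    qed auto
    finally show ?thesis using integral_open_interval_real[of a x g] by (simp add: u_def)
  qed
  have "g integrable_on {a<..<b}" using g by (intro integrable_on_lebesgue_on) auto
  then have "g integrable_on {a..b}" using integrable_on_Icc_iff_Ioo by blast
  then have "continuous_on {a..b} (\<lambda>x. A + integral {a..x} g)"
    by (intro continuous_intros indefinite_integral_continuous_1)
  then show "continuous_on {a..b} u" by (subst continuous_on_cong[OF refl eq]) auto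
  show "u a = A" using eq[of a] ab by simp
  have "(\<integral>t. (if t < b then g t else 0) \<partial>?M) = (\<integral>t. g t \<partial>?M)"
    by (intro Bochner_Integration.integral_cong) auto
  then show "u b = A + (\<integral>t. g t \<partial>?M)" by (simp add: u_def)
qed

lemma integrable_imp_locally_integrable:
  fixes f :: "real \<Rightarrow> real"
  assumes "integrable (lebesgue_on {a<..<b}) f"
  shows "locally_integrable a b f"
  unfolding locally_integrable_def
proof (intro allI impI)
  fix K :: "real set" assume K: "compact K \<and> K \<subseteq> {a<..<b}"
  have "set_integrable lebesgue {a<..<b} f"
    using assms by (simp add: integrable_restrict_space set_integrable_def)
  then show "set_integrable lebesgue K f"
    by (rule set_integrable_subset) (use K in \<open>auto intro: fmeasurableD lmeasurable_compact\<close>)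
qed

text \<open>Integration by parts against a test function: Fubini on the triangle \<open>t < x\<close>.\<close>

lemma has_weak_deriv_indefinite_integral:
  fixes g :: "real \<Rightarrow> real" and A :: real
  assumes ab: "a < b" and g: "integrable (lebesgue_on {a<..<b}) g"
  defines "u \<equiv> \<lambda>x. A + (\<integral>t. (if t < x then g t else 0) \<partial>lebesgue_on {a<..<b})"
  shows "has_weak_deriv a b u g"
  unfolding has_weak_deriv_def
proof (intro conjI ballI)
  let ?M = "lebesgue_on {a<..<b}"
  show "locally_integrable a b g" using g by (rule integrable_imp_locally_integrable)
  have ucont: "continuous_on {a..b} u" using indefinite_integral_lebesgue(1)[OF ab g] by (simp add: u_def)
  then show "locally_integrable a b u"
    by (intro integrable_imp_locally_integrable integral_lebesgue_Ioo_continuous)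
  fix \<phi> assume \<phi>: "\<phi> \<in> test_functions a b"
  interpret M: finite_measure ?M by (rule finite_measure_lebesgue_Ioo)
  interpret P: pair_sigma_finite ?M ?M by unfold_locales
  have sm: "smooth \<phi>" and \<phi>0: "\<And>x. x \<notin> {a<..<b} \<Longrightarrow> \<phi> x = 0" using test_functionsD[OF \<phi>] by auto
  have dcont: "continuous_on X (deriv \<phi>)" for X by (intro smooth_continuous_on smooth_deriv sm)
  have d: "integrable ?M (deriv \<phi>)" by (intro integral_lebesgue_Ioo_continuous dcont)
  \<comment> \<open>The inner integral over the triangle for fixed t; since the test function
    vanishes at b, only its value at t remains.\<close>
  have FTC: "(\<integral>x. (if t < x then deriv \<phi> x else 0) \<partial>?M) = - \<phi> t" if t: "a \<le> t" "t \<le> b" for t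
  proof -
    have "(\<integral>x. (if t < x then deriv \<phi> x else 0) \<partial>?M)
        = (\<integral>x. indicator {a<..<b} x *\<^sub>R (if t < x then deriv \<phi> x else 0) \<partial>lebesgue)"
      by (subst integral_restrict_space) auto
    also have "\<dots> = (\<integral>x. indicator {t<..<b} x *\<^sub>R deriv \<phi> x \<partial>lebesgue)"
      using t by (intro Bochner_Integration.integral_cong) (auto simp: indicator_def)
    also have "\<dots> = (\<integral>x. deriv \<phi> x \<partial>lebesgue_on {t<..<b})"
      by (subst integral_restrict_space) auto
    also have "\<dots> = integral {t..b} (deriv \<phi>)"
      by (intro integral_lebesgue_Ioo_continuous dcont)
    also have "\<dots> = \<phi> b - \<phi> t"
      using t smooth_has_deriv[OF sm]
      by (intro integral_unique fundamental_theorem_of_calculus)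
        (auto simp: has_real_derivative_iff_has_vector_derivative has_vector_derivative_at_within)
    finally show ?thesis using \<phi>0[of b] by simp
  qed
  have FTC0: "(\<integral>x. deriv \<phi> x \<partial>?M) = 0"
  proof -
    have "(\<integral>x. deriv \<phi> x \<partial>?M) = (\<integral>x. (if a < x then deriv \<phi> x else 0) \<partial>?M)"
      by (intro Bochner_Integration.integral_cong) auto
    then show ?thesis using FTC[of a] ab \<phi>0[of a] by simp
  qed
  have meas: "g \<in> borel_measurable ?M" "deriv \<phi> \<in> borel_measurable ?M" using g d by auto
  note [measurable] = meas borel_measurable_ident_lebesgue_on
  have lt: "Measurable.pred (?M \<Otimes>\<^sub>M ?M) (\<lambda>p. snd p < fst p)"
    using measurable_compose[OF measurable_fst borel_measurable_ident_lebesgue_on]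
      measurable_compose[OF measurable_snd borel_measurable_ident_lebesgue_on]
    by (intro borel_measurable_pred_less) auto
  note [measurable] = lt
  define F where "F = (\<lambda>x t. if t < x then g t * deriv \<phi> x else 0)"
  have Fm: "(\<lambda>(x, t). F x t) \<in> borel_measurable (?M \<Otimes>\<^sub>M ?M)"
    unfolding F_def split_beta by measurable
  \<comment> \<open>The cutoff only lowers absolute values, so F is dominated by the product
    \<open>g t * deriv \<phi> x\<close>, which is integrable over the square.\<close>
  have i: "integrable (?M \<Otimes>\<^sub>M ?M) (\<lambda>(x, t). F x t)"
  proof (rule Bochner_Integration.integrable_bound)
    show "integrable (?M \<Otimes>\<^sub>M ?M) (\<lambda>(x, t). g t * deriv \<phi> x)"
    proof (rule P.Fubini_integrable)
      show "(\<lambda>(x, t). g t * deriv \<phi> x) \<in> borel_measurable (?M \<Otimes>\<^sub>M ?M)"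
        unfolding split_beta by measurable
      have "(\<lambda>x. \<integral>t. norm (case (x, t) of (x, t) \<Rightarrow> g t * deriv \<phi> x) \<partial>?M)
         = (\<lambda>x. (\<integral>t. norm (g t) \<partial>?M) * norm (deriv \<phi> x))"
        by (auto simp: abs_mult)
      then show "integrable ?M (\<lambda>x. \<integral>t. norm (case (x, t) of (x, t) \<Rightarrow> g t * deriv \<phi> x) \<partial>?M)"
        using d by simp
      show "AE x in ?M. integrable ?M (\<lambda>t. case (x, t) of (x, t) \<Rightarrow> g t * deriv \<phi> x)"
        using g by simp
    qed
  qed (use Fm in \<open>auto simp: F_def\<close>)
  have inner: "(\<integral>t. F x t \<partial>?M) = (u x - A) * deriv \<phi> x" for x
  proof -
    have "(\<integral>t. F x t \<partial>?M) = (\<integral>t. (if t < x then g t else 0) * deriv \<phi> x \<partial>?M)"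
      by (intro Bochner_Integration.integral_cong) (auto simp: F_def)
    then show ?thesis by (simp add: u_def)
  qed
  \<comment> \<open>The constant A contributes nothing, since the derivative of a test function
    integrates to zero; the rest is the double integral of F.\<close>
  have "(\<integral>x. u x * deriv \<phi> x \<partial>?M) = (\<integral>x. A * deriv \<phi> x + (u x - A) * deriv \<phi> x \<partial>?M)"
    by (simp add: algebra_simps)
  also have "\<dots> = (\<integral>x. A * deriv \<phi> x \<partial>?M) + (\<integral>x. (u x - A) * deriv \<phi> x \<partial>?M)"
    by (intro Bochner_Integration.integral_add integral_lebesgue_Ioo_continuous(1) continuous_intros ucont dcont)
  also have "\<dots> = (\<integral>x. \<integral>t. F x t \<partial>?M \<partial>?M)" by (simp add: FTC0 inner)
  also have "\<dots> = (\<integral>t. \<integral>x. F x t \<partial>?M \<partial>?M)"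
    using P.Fubini_integral[OF i] by simp
  also have "\<dots> = (\<integral>t. - (g t * \<phi> t) \<partial>?M)"
  proof (rule Bochner_Integration.integral_cong[OF refl])
    fix t assume "t \<in> space ?M"
    then have "a \<le> t" "t \<le> b" by auto
    have "(\<integral>x. F x t \<partial>?M) = (\<integral>x. g t * (if t < x then deriv \<phi> x else 0) \<partial>?M)"
      by (intro Bochner_Integration.integral_cong) (auto simp: F_def)
    also have "\<dots> = g t * (\<integral>x. (if t < x then deriv \<phi> x else 0) \<partial>?M)" by simp
    finally show "(\<integral>x. F x t \<partial>?M) = - (g t * \<phi> t)" using FTC[OF \<open>a \<le> t\<close> \<open>t \<le> b\<close>] by simp
  qed
  finally show "(\<integral>x. u x * deriv \<phi> x \<partial>?M) = - (\<integral>x. g x * \<phi> x \<partial>?M)" by simp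
qed

subsection \<open>Weighted integrals of powers\<close>

text \<open>One bound for small and large K: the first summand dominates for K < 1, the second for K
  \<ge> 1.\<close>

lemma powr_le_powr_add:
  fixes K :: real
  assumes "0 < K" "\<alpha> \<le> r" "r \<le> \<beta>"
  shows "K powr r \<le> K powr \<alpha> + K powr \<beta>"
proof (cases "1 \<le> K")
  case True
  then have "K powr r \<le> K powr \<beta>" using assms by (intro powr_mono) auto
  then show ?thesis by (simp add: add_increasing)
next
  case False
  then have "K powr r \<le> K powr \<alpha>" using assms by (intro powr_mono') auto
  then show ?thesis by (simp add: add_increasing2)
qed

text \<open>Instantiated twice: with weight \<open>\<gamma> powr (- q)\<close> for the flux of the
  minimizer and with weight 1 for \<open>Kbar\<close>. In both cases the boundary difference m
  equals \<open>F K\<close>, so the inverse of F and its asymptotics are studied once.\<close>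

locale weighted_powr = finite_measure M for M :: "'a measure" +
  fixes w q :: "'a \<Rightarrow> real" and \<alpha> \<beta> w0 w1 :: real
  assumes w_meas: "w \<in> borel_measurable M" and q_meas: "q \<in> borel_measurable M"
    and \<alpha>_pos: "0 < \<alpha>" and w0_pos: "0 < w0"
    and w_ge: "AE x in M. w0 \<le> w x" and w_le: "AE x in M. w x \<le> w1"
    and q_ge: "AE x in M. \<alpha> \<le> q x" and q_le: "AE x in M. q x \<le> \<beta>"
    and mass: "0 < measure M (space M)"
begin

definition F :: "real \<Rightarrow> real" where
  "F K = (\<integral>x. w x * K powr q x \<partial>M)"

lemma powr_meas: "(\<lambda>x. w x * K powr q x) \<in> borel_measurable M"
  using w_meas q_meas by measurable

lemma AE_bound: "0 < K \<Longrightarrow> AE x in M. norm (w x * K powr q x) \<le> w1 * (K powr \<alpha> + K powr \<beta>)"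
  using w_ge w_le q_ge q_le
proof eventually_elim
  case (elim x)
  have "w x * K powr q x \<le> w1 * (K powr \<alpha> + K powr \<beta>)"
    using elim w0_pos by (intro mult_mono powr_le_powr_add) auto
  then show ?case using elim w0_pos by simp
qed

lemma integrable_F: "0 < K \<Longrightarrow> integrable M (\<lambda>x. w x * K powr q x)"
  by (rule integrable_const_bound[OF AE_bound powr_meas])

lemma F_strict_mono:
  assumes "0 < K" "K < K'"
  shows "F K < F K'"
  unfolding F_def
proof (rule integral_less_AE_space)
  show "AE x in M. w x * K powr q x < w x * K' powr q x"
    using w_ge q_ge
  proof eventually_elim
    case (elim x)
    then show ?case using assms w0_pos \<alpha>_pos by (intro mult_strict_left_mono powr_less_mono2) auto
  qed
  show "emeasure M (space M) \<noteq> 0" using mass by (auto simp: measure_def)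
qed (use assms in \<open>auto intro: integrable_F\<close>)

lemma F_mono: "0 < K \<Longrightarrow> K \<le> K' \<Longrightarrow> F K \<le> F K'"
  using F_strict_mono[of K K'] by (cases "K = K'") auto

lemma F_less_iff: "0 < K \<Longrightarrow> 0 < K' \<Longrightarrow> F K < F K' \<longleftrightarrow> K < K'"
  using F_strict_mono[of K K'] F_mono[of K' K] by (cases "K < K'") auto

lemma F_pos: "0 < K \<Longrightarrow> 0 < F K"
proof -
  assume K: "0 < K"
  have "(\<integral>x. 0 \<partial>M) < F K" unfolding F_def
  proof (rule integral_less_AE_space)
    show "AE x in M. 0 < w x * K powr q x"
      using w_ge by eventually_elim (use K w0_pos in auto)
    show "emeasure M (space M) \<noteq> 0" using mass by (auto simp: measure_def)
  qed (use K in \<open>auto intro: integrable_F\<close>)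
  then show ?thesis by simp
qed

lemma F_continuous:
  assumes "0 < K1"
  shows "continuous_on {K1..K2} F"
  unfolding continuous_on_sequentially
proof (intro allI ballI impI)
  fix X :: "nat \<Rightarrow> real" and K
  assume K: "K \<in> {K1..K2}" and X: "(\<forall>n. X n \<in> {K1..K2}) \<and> X \<longlonglongrightarrow> K"
  have pos: "0 < K" "\<And>n. 0 < X n" "\<And>n. X n \<le> K2" using K X assms by (auto intro: less_le_trans)
  have "(\<lambda>n. \<integral>x. w x * X n powr q x \<partial>M) \<longlonglongrightarrow> (\<integral>x. w x * K powr q x \<partial>M)"
  proof (rule integral_dominated_convergence)
    \<comment> \<open>As q is positive almost everywhere, the integrand increases with the base, and
      its value at the right end \<open>K2\<close> dominates the sequence.\<close>
    show "integrable M (\<lambda>x. w x * K2 powr q x)" using K assms by (intro integrable_F) auto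
    show "AE x in M. (\<lambda>n. w x * X n powr q x) \<longlonglongrightarrow> w x * K powr q x"
      using pos X by (intro AE_I2 tendsto_intros) auto
    show "AE x in M. norm (w x * X n powr q x) \<le> w x * K2 powr q x" for n
      using w_ge q_ge
    proof eventually_elim
      case (elim x)
      then show ?case using w0_pos \<alpha>_pos pos(2,3)[of n] by (auto intro!: mult_left_mono powr_mono2)
    qed
  qed (rule powr_meas)+
  then show "(F \<circ> X) \<longlonglongrightarrow> F K" by (simp add: F_def o_def)
qed

lemma w1_pos: "0 < w1"
proof (rule ccontr)
  assume "\<not> 0 < w1"
  have "AE x in M. False" using w_ge w_le by eventually_elim (use w0_pos \<open>\<not> 0 < w1\<close> in linarith)
  then have "ae_filter M = bot" by (simp add: trivial_limit_def)
  then show False using mass by (simp add: ae_filter_eq_bot_iff measure_def)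
qed

lemma F_ex1:
  assumes m: "0 < m"
  shows "\<exists>!K. 0 < K \<and> m = F K"
proof -
  let ?\<mu> = "measure M (space M)"
  \<comment> \<open>F is at most w1 K^\<alpha> times the mass for K \<le> 1 and at least w0
    K^\<alpha> times the mass for K \<ge> 1. \<open>K1\<close> and \<open>K2\<close> come from
    equating these bounds with m; the caps at 1 keep them in the ranges where the bounds
    hold.\<close>
  define K1 where "K1 = min 1 ((m / (w1 * ?\<mu>)) powr (1 / \<alpha>))"
  define K2 where "K2 = max 1 ((m / (w0 * ?\<mu>)) powr (1 / \<alpha>))"
  have K: "0 < K1" "K1 \<le> 1" "1 \<le> K2" "K1 \<le> K2"
    using m w1_pos mass by (auto simp: K1_def K2_def min_def max_def)
  have c: "F K1 \<le> w1 * K1 powr \<alpha> * ?\<mu>"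
  proof -
    have "F K1 \<le> (\<integral>x. w1 * K1 powr \<alpha> \<partial>M)" unfolding F_def
    proof (rule integral_mono_AE)
      show "AE x in M. w x * K1 powr q x \<le> w1 * K1 powr \<alpha>"
        using w_ge w_le q_ge
      proof eventually_elim
        case (elim x)
        then show ?case using w0_pos K by (intro mult_mono powr_mono') auto
      qed
    qed (use K in \<open>auto intro: integrable_F\<close>)
    then show ?thesis by (simp add: mult_ac)
  qed
  have d: "w0 * K2 powr \<alpha> * ?\<mu> \<le> F K2"
  proof -
    have "(\<integral>x. w0 * K2 powr \<alpha> \<partial>M) \<le> F K2" unfolding F_def
    proof (rule integral_mono_AE)
      show "AE x in M. w0 * K2 powr \<alpha> \<le> w x * K2 powr q x"
        using w_ge q_ge
      proof eventually_elim
        case (elim x)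
        then show ?case using w0_pos K by (intro mult_mono powr_mono) auto
      qed
    qed (use K in \<open>auto intro: integrable_F\<close>)
    then show ?thesis by (simp add: mult_ac)
  qed
  have "K1 powr \<alpha> \<le> ((m / (w1 * ?\<mu>)) powr (1 / \<alpha>)) powr \<alpha>"
    using K \<alpha>_pos by (intro powr_mono2) (auto simp: K1_def)
  then have "K1 powr \<alpha> \<le> m / (w1 * ?\<mu>)" using \<alpha>_pos m w1_pos mass by (simp add: powr_powr)
  then have "w1 * K1 powr \<alpha> * ?\<mu> \<le> m" using w1_pos mass by (simp add: field_simps)
  then have lo: "F K1 \<le> m" using c by simp
  have "((m / (w0 * ?\<mu>)) powr (1 / \<alpha>)) powr \<alpha> \<le> K2 powr \<alpha>"
    using K \<alpha>_pos by (intro powr_mono2) (auto simp: K2_def)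
  then have "m / (w0 * ?\<mu>) \<le> K2 powr \<alpha>" using \<alpha>_pos m w0_pos mass by (simp add: powr_powr)
  then have "m \<le> w0 * K2 powr \<alpha> * ?\<mu>" using w0_pos mass by (simp add: field_simps)
  then have hi: "m \<le> F K2" using d by simp
  obtain K where "K1 \<le> K" "K \<le> K2" "F K = m"
    using IVT'[of F K1 m K2] lo hi K F_continuous[of K1 K2] by auto
  then have "0 < K \<and> m = F K" using K by auto
  moreover have "K = K'" if "0 < K \<and> m = F K" "0 < K' \<and> m = F K'" for K K'
    using that F_less_iff[of K K'] F_less_iff[of K' K] by (metis less_irrefl linorder_neqE)
  ultimately show ?thesis by blast
qed

lemma inverse_at_top:
  assumes "\<And>m. 0 < m \<Longrightarrow> 0 < k m \<and> m = F (k m)"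
  shows "filterlim k at_top at_top"
  unfolding filterlim_at_top
proof
  fix Z :: real
  show "\<forall>\<^sub>F m in at_top. Z \<le> k m"
    \<comment> \<open>F is increasing, so m above \<open>F (max 1 Z)\<close> forces
      \<open>k m\<close> above Z; the inner maximum keeps the argument of F positive.\<close>
    using eventually_gt_at_top[of "max 0 (F (max 1 Z))"]
  proof eventually_elim
    case (elim m)
    then have m: "0 < m" "F (max 1 Z) < F (k m)" using assms[of m] by auto
    then have "max 1 Z < k m" using assms[of m] F_less_iff[of "max 1 Z" "k m"] by simp
    then show ?case by simp
  qed
qed

lemma inverse_at_right_0:
  assumes "\<And>m. 0 < m \<Longrightarrow> 0 < k m \<and> m = F (k m)"
  shows "filterlim k (at_right 0) (at_right 0)"
  unfolding filterlim_at
proof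
  show "\<forall>\<^sub>F m in at_right 0. k m \<in> {0<..} \<and> k m \<noteq> 0"
    using eventually_at_right_less[of "0::real"]
    by eventually_elim (use assms in force)
  show "(k \<longlongrightarrow> 0) (at_right 0)"
  proof (rule order_tendstoI)
    fix y :: real assume "y < 0"
    show "\<forall>\<^sub>F m in at_right 0. y < k m"
      using eventually_at_right_less[of "0::real"]
    proof eventually_elim
      case (elim m)
      then show ?case using assms[of m] \<open>y < 0\<close> by simp
    qed
  next
    fix y :: real assume y: "0 < y"
    have "\<forall>\<^sub>F m in at_right 0. m \<in> {0<..<F y}"
      using F_pos[OF y] by (rule eventually_at_right_real)
    then show "\<forall>\<^sub>F m in at_right 0. k m < y"
    proof eventually_elim
      case (elim m)
      then show ?case using assms[of m] y F_less_iff[of "k m" y] by auto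
    qed
  qed
qed

text \<open>Pointwise K^(-h) tends to 1 where h = 0 and to 0 where h > 0, and for K \<ge> 1 it is at
  most 1. Both asymptotics of F reduce to this, with h the distance from q to \<beta> or to
  \<alpha>.\<close>

lemma powr_neg_limit:
  assumes h: "h \<in> borel_measurable M" "AE x in M. 0 \<le> h x"
  shows "((\<lambda>K. \<integral>x. w x * K powr (- h x) \<partial>M) \<longlongrightarrow> (\<integral>x. w x * indicator {x. h x = 0} x \<partial>M)) at_top"
proof (rule tendsto_at_topI_sequentially)
  fix X :: "nat \<Rightarrow> real" assume X: "filterlim X at_top sequentially"
  obtain N where N: "\<And>n. N \<le> n \<Longrightarrow> 1 \<le> X n"
    using X unfolding filterlim_at_top eventually_sequentially by blast
  \<comment> \<open>The shift by N makes the domination, which requires a base of at least 1, hold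
    for every index.\<close>
  have "(\<lambda>n. \<integral>x. w x * X (n + N) powr (- h x) \<partial>M) \<longlonglongrightarrow> (\<integral>x. w x * indicator {x. h x = 0} x \<partial>M)"
  proof (rule integral_dominated_convergence)
    show "integrable M (\<lambda>x. w1)" by simp
    show "(\<lambda>x. w x * indicator {x. h x = 0} x) \<in> borel_measurable M"
      using w_meas h(1) unfolding indicator_def by measurable
    show "(\<lambda>x. w x * X (n + N) powr (- h x)) \<in> borel_measurable M" for n
      using w_meas h(1) by measurable
    show "AE x in M. norm (w x * X (n + N) powr (- h x)) \<le> w1" for n
      using w_ge w_le h(2)
    proof eventually_elim
      case (elim x)
      have "X (n + N) powr (- h x) \<le> X (n + N) powr 0" using N[of "n + N"] elim by (intro powr_mono) auto
      then have "X (n + N) powr (- h x) \<le> 1" using N[of "n + N"] by simp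
      then have "w x * X (n + N) powr (- h x) \<le> w1 * 1" using elim w0_pos by (intro mult_mono) auto
      then show ?case using elim w0_pos by simp
    qed
    have X': "filterlim (\<lambda>n. X (n + N)) at_top sequentially"
      using X by (rule filterlim_compose) (rule filterlim_add_const_nat_at_top)
    show "AE x in M. (\<lambda>n. w x * X (n + N) powr (- h x)) \<longlonglongrightarrow> w x * indicator {x. h x = 0} x"
      using h(2)
    proof eventually_elim
      case (elim x)
      show ?case
      proof (cases "h x = 0")
        case True
        have "X (n + N) powr 0 = 1" for n using N[of "n + N"] by simp
        then show ?thesis using True by simp
      next
        case False
        then have "(\<lambda>n. X (n + N) powr (- h x)) \<longlonglongrightarrow> 0"
          using elim by (intro tendsto_neg_powr X') auto
        then show ?thesis using False by (auto intro: tendsto_mult_right_zero)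
      qed
    qed
  qed
  then show "(\<lambda>n. \<integral>x. w x * X n powr (- h x) \<partial>M) \<longlonglongrightarrow> (\<integral>x. w x * indicator {x. h x = 0} x \<partial>M)"
    by (rule LIMSEQ_offset)
qed

lemma F_div_powr: "0 < K \<Longrightarrow> F K / K powr r = (\<integral>x. w x * K powr (q x - r) \<partial>M)"
  by (simp add: F_def powr_diff flip: integral_divide_zero)

lemma F_asymp_at_top:
  "((\<lambda>K. F K / K powr \<beta>) \<longlongrightarrow> (\<integral>x. w x * indicator {x. q x = \<beta>} x \<partial>M)) at_top"
proof -
  have "((\<lambda>K. \<integral>x. w x * K powr (- (\<beta> - q x)) \<partial>M) \<longlongrightarrow> (\<integral>x. w x * indicator {x. \<beta> - q x = 0} x \<partial>M)) at_top"
    by (rule powr_neg_limit) (use q_meas q_le in auto)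
  moreover have "{x. \<beta> - q x = 0} = {x. q x = \<beta>}" by auto
  moreover have "\<forall>\<^sub>F K in at_top. (\<integral>x. w x * K powr (- (\<beta> - q x)) \<partial>M) = F K / K powr \<beta>"
    using eventually_gt_at_top[of "0::real"] by eventually_elim (simp add: F_div_powr)
  ultimately show ?thesis by (simp add: tendsto_cong)
qed

text \<open>Substituting 1/K for K turns the limit at zero into one at infinity, with q - \<alpha>
  in the role of h.\<close>

lemma F_asymp_at_right_0:
  "((\<lambda>K. F K / K powr \<alpha>) \<longlongrightarrow> (\<integral>x. w x * indicator {x. q x = \<alpha>} x \<partial>M)) (at_right 0)"
  unfolding filterlim_at_right_to_top
proof -
  have "((\<lambda>K. \<integral>x. w x * K powr (- (q x - \<alpha>)) \<partial>M) \<longlongrightarrow> (\<integral>x. w x * indicator {x. q x - \<alpha> = 0} x \<partial>M)) at_top"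
    by (rule powr_neg_limit) (use q_meas q_ge in auto)
  moreover have "{x. q x - \<alpha> = 0} = {x. q x = \<alpha>}" by auto
  moreover have "\<forall>\<^sub>F K in at_top. (\<integral>x. w x * K powr (- (q x - \<alpha>)) \<partial>M) = F (inverse K) / inverse K powr \<alpha>"
    using eventually_gt_at_top[of "0::real"]
  proof eventually_elim
    case (elim K)
    have "inverse K powr (q x - \<alpha>) = K powr (- (q x - \<alpha>))" for x
      using elim by (simp only: powr_minus inverse_powr)
    then show ?case using elim by (simp add: F_div_powr)
  qed
  ultimately show "((\<lambda>K. F (inverse K) / inverse K powr \<alpha>) \<longlongrightarrow> (\<integral>x. w x * indicator {x. q x = \<alpha>} x \<partial>M)) at_top"
    by (simp add: tendsto_cong)
qed

end

text \<open>Everything is expressed through the two convergent quotients: \<open>k m / K m\<close>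
  is the power 1/\<beta> of their ratio. The product \<open>k m * m\<close> is the value of the
  Dirichlet-to-Neumann map; the filter is left open to cover both limits.\<close>

lemma ratio_limit:
  fixes k K :: "real \<Rightarrow> real"
  assumes ev: "\<forall>\<^sub>F m in \<F>. 0 < m" "\<forall>\<^sub>F m in \<F>. 0 < k m" "\<forall>\<^sub>F m in \<F>. 0 < K m"
    and pos: "0 < W" "0 < Q" "0 < \<beta>"
    and k: "((\<lambda>m. m / k m powr \<beta>) \<longlongrightarrow> W) \<F>" and K: "((\<lambda>m. m / K m powr \<beta>) \<longlongrightarrow> Q) \<F>"
  shows "((\<lambda>m. K m powr (- (1 + \<beta>)) * (1 / Q) * (k m * m)) \<longlongrightarrow> (1 / Q * W) powr (- (1 / \<beta>))) \<F>"
proof -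
  have "((\<lambda>m. (m / K m powr \<beta>) * (1 / Q) * ((m / K m powr \<beta>) / (m / k m powr \<beta>)) powr (1 / \<beta>))
      \<longlongrightarrow> Q * (1 / Q) * (Q / W) powr (1 / \<beta>)) \<F>"
    using pos by (intro tendsto_intros k K) auto
  also have "Q * (1 / Q) * (Q / W) powr (1 / \<beta>) = (1 / Q * W) powr (- (1 / \<beta>))"
    using pos by (simp add: powr_minus powr_divide)
  finally have lim: "((\<lambda>m. (m / K m powr \<beta>) * (1 / Q) * ((m / K m powr \<beta>) / (m / k m powr \<beta>)) powr (1 / \<beta>))
      \<longlongrightarrow> (1 / Q * W) powr (- (1 / \<beta>))) \<F>" .
  have "\<forall>\<^sub>F m in \<F>. (m / K m powr \<beta>) * (1 / Q) * ((m / K m powr \<beta>) / (m / k m powr \<beta>)) powr (1 / \<beta>)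
      = K m powr (- (1 + \<beta>)) * (1 / Q) * (k m * m)"
    using ev
  proof eventually_elim
    case (elim m)
    have "(m / K m powr \<beta>) / (m / k m powr \<beta>) = (k m / K m) powr \<beta>"
      using elim by (simp add: powr_divide)
    then have "((m / K m powr \<beta>) / (m / k m powr \<beta>)) powr (1 / \<beta>) = k m / K m"
      using elim pos by (simp add: powr_powr)
    moreover have "K m powr (- (1 + \<beta>)) = 1 / (K m * K m powr \<beta>)"
      using elim by (simp only: powr_minus powr_add inverse_eq_divide powr_one)
    ultimately show ?case by (simp only: times_divide_eq_left times_divide_eq_right mult_1_left divide_divide_eq_left mult_ac)
  qed
  then show ?thesis using lim by (rule Lim_transform_eventually[rotated])
qed

subsection \<open>The minimizer and the Dirichlet-to-Neumann map\<close>

text \<open>Strict Bernoulli inequality: by the mean value theorem the slope exceeds r to the right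
  of 1 and lies below r to the left. Strictness later yields uniqueness of the minimizer's
  derivative.\<close>

lemma powr_tangent_less:
  fixes t r :: real
  assumes "0 \<le> t" "t \<noteq> 1" "1 < r"
  shows "1 + r * (t - 1) < t powr r"
proof (cases "t = 0")
  case True
  then show ?thesis using assms by simp
next
  case False
  then have t: "0 < t" using assms by simp
  have d: "((\<lambda>x. x powr r) has_real_derivative r * x powr (r - 1)) (at x)" if "0 < x" for x
    using that by (auto intro!: derivative_eq_intros)
  consider "1 < t" | "t < 1" using assms by linarith
  then show ?thesis
  proof cases
    case 1
    obtain z where z: "1 < z" "z < t" "t powr r - 1 powr r = (t - 1) * (r * z powr (r - 1))"
      using MVT2[OF 1, of "\<lambda>x. x powr r" "\<lambda>x. r * x powr (r - 1)"] d by auto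
    have "1 < z powr (r - 1)" using powr_less_mono2[of "r - 1" 1 z] z assms by simp
    then have "(t - 1) * (r * 1) < (t - 1) * (r * z powr (r - 1))" using 1 assms by simp
    then show ?thesis using z(3) by (simp add: algebra_simps)
  next
    case 2
    obtain z where z: "t < z" "z < 1" "1 powr r - t powr r = (1 - t) * (r * z powr (r - 1))"
      using MVT2[OF 2, of "\<lambda>x. x powr r" "\<lambda>x. r * x powr (r - 1)"] d t by auto
    have "z powr (r - 1) < 1" using powr_less_mono2[of "r - 1" z 1] z t assms by simp
    then have "(1 - t) * (r * z powr (r - 1)) < (1 - t) * (r * 1)" using 2 assms by simp
    then show ?thesis using z(3) by (simp add: algebra_simps)
  qed
qed

text \<open>Scaling reduces to the Bernoulli inequality at t = |s|/g. A negative s only lowers the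
  tangent, so it may be replaced by |s|; equality forces |s| = g and then makes the linear term
  vanish.\<close>

lemma abs_powr_tangent:
  fixes s g r :: real
  assumes "0 < g" "1 < r"
  shows "g powr r + r * g powr (r - 1) * (s - g) \<le> \<bar>s\<bar> powr r"
    and "g powr r + r * g powr (r - 1) * (s - g) = \<bar>s\<bar> powr r \<Longrightarrow> s = g"
proof -
  define t where "t = \<bar>s\<bar> / g"
  have t: "0 \<le> t" "\<bar>s\<bar> = t * g" using assms by (auto simp: t_def)
  have gr: "g powr r = g powr (r - 1) * g" using assms by (simp add: powr_diff)
  have L: "g powr r + r * g powr (r - 1) * (\<bar>s\<bar> - g) = g powr r * (1 + r * (t - 1))"
    unfolding gr t(2) by (simp add: algebra_simps)
  have R: "\<bar>s\<bar> powr r = g powr r * t powr r" unfolding t(2) using t assms by (simp add: powr_mult)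
  have abs_le: "g powr r + r * g powr (r - 1) * (s - g) \<le> g powr r + r * g powr (r - 1) * (\<bar>s\<bar> - g)"
    using assms by (intro add_left_mono mult_left_mono) auto
  have less: "g powr r + r * g powr (r - 1) * (\<bar>s\<bar> - g) < \<bar>s\<bar> powr r" if "\<bar>s\<bar> \<noteq> g"
    unfolding L R using powr_tangent_less[OF t(1) _ assms(2)] that assms t by (intro mult_strict_left_mono) auto
  show "g powr r + r * g powr (r - 1) * (s - g) \<le> \<bar>s\<bar> powr r"
    using abs_le less by (cases "\<bar>s\<bar> = g") auto
  assume eq: "g powr r + r * g powr (r - 1) * (s - g) = \<bar>s\<bar> powr r"
  then have sg: "\<bar>s\<bar> = g" using abs_le less by force
  then have "r * g powr (r - 1) * (s - g) = 0" using eq by simp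
  then show "s = g" using assms by simp
qed

locale DN_problem =
  fixes a b :: real and p \<gamma> :: "real \<Rightarrow> real" and pm pp c C :: real
  assumes ab: "a < b"
    and p_meas: "p \<in> borel_measurable (lebesgue_on {a<..<b})"
    and \<gamma>_meas: "\<gamma> \<in> borel_measurable (lebesgue_on {a<..<b})"
    and pm: "1 < pm" and c: "0 < c"
    and p_ge: "AE x in lebesgue_on {a<..<b}. pm \<le> p x" and p_le: "AE x in lebesgue_on {a<..<b}. p x \<le> pp"
    and \<gamma>_ge: "AE x in lebesgue_on {a<..<b}. c \<le> \<gamma> x" and \<gamma>_le: "AE x in lebesgue_on {a<..<b}. \<gamma> x \<le> C"
begin

abbreviation "M \<equiv> lebesgue_on {a<..<b}"

sublocale finite_measure M by (rule finite_measure_lebesgue_Ioo)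

definition q where "q = (\<lambda>x. 1 / (p x - 1))"

definition w where "w = (\<lambda>x. \<gamma> x powr (- q x))"

lemma mass_pos: "0 < measure M (space M)"
  using ab by (simp add: measure_restrict_space)

lemma AE_exE: assumes "AE x in M. P x" obtains x where "P x"
proof -
  have "ae_filter M \<noteq> bot" using mass_pos by (auto simp: ae_filter_eq_bot_iff measure_def)
  then show ?thesis using assms that eventually_happens by blast
qed

lemma cC: "c \<le> C"
proof -
  have "AE x in M. c \<le> C" using \<gamma>_ge \<gamma>_le by eventually_elim simp
  then show ?thesis by (rule AE_exE)
qed

lemma pm_pp: "pm \<le> pp"
proof -
  have "AE x in M. pm \<le> pp" using p_ge p_le by eventually_elim simp
  then show ?thesis by (rule AE_exE)
qed

lemma q_meas: "q \<in> borel_measurable M"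
  unfolding q_def using p_meas by measurable

lemma w_meas: "w \<in> borel_measurable M"
  unfolding w_def using \<gamma>_meas q_meas by measurable

lemma q_ge: "AE x in M. 1 / (pp - 1) \<le> q x"
  using p_ge p_le by eventually_elim (use pm in \<open>auto simp: q_def intro!: divide_left_mono\<close>)

lemma q_le: "AE x in M. q x \<le> 1 / (pm - 1)"
  using p_ge by eventually_elim (use pm in \<open>auto simp: q_def intro!: divide_left_mono\<close>)

text \<open>The weight is (1/\<gamma>)^q. Capping 1/C at 1 makes the power decrease in the exponent,
  so the largest exponent gives a bound uniform in x; for the upper bound the maximum with 1 does
  the reverse.\<close>

lemma w_ge: "AE x in M. min 1 (1 / C) powr (1 / (pm - 1)) \<le> w x"
  using q_le q_ge \<gamma>_ge \<gamma>_le
proof eventually_elim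
  case (elim x)
  have q0: "0 \<le> q x" using elim(2) pm pm_pp by (auto intro: order_trans[rotated])
  have "min 1 (1 / C) powr (1 / (pm - 1)) \<le> min 1 (1 / C) powr q x"
    using elim c cC by (intro powr_mono') auto
  also have "\<dots> \<le> (1 / \<gamma> x) powr q x"
    using elim c cC q0 by (intro powr_mono2) (auto simp: min_le_iff_disj intro!: divide_left_mono)
  also have "\<dots> = w x" using elim c by (simp add: w_def powr_minus powr_divide inverse_eq_divide)
  finally show ?case .
qed

lemma w_le: "AE x in M. w x \<le> max 1 (1 / c) powr (1 / (pm - 1))"
  using q_le q_ge \<gamma>_ge
proof eventually_elim
  case (elim x)
  have q0: "0 \<le> q x" using elim(2) pm pm_pp by (auto intro: order_trans[rotated])
  have "w x = (1 / \<gamma> x) powr q x" using elim c by (simp add: w_def powr_minus powr_divide inverse_eq_divide)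
  also have "\<dots> \<le> max 1 (1 / c) powr q x"
    using elim c q0 by (intro powr_mono2) (auto simp: le_max_iff_disj intro!: divide_left_mono)
  also have "\<dots> \<le> max 1 (1 / c) powr (1 / (pm - 1))"
    using elim by (intro powr_mono) auto
  finally show ?case .
qed

text \<open>q decreases in p, so \<open>pp\<close> supplies the lower exponent and \<open>pm\<close>
  the upper one. This reversal is why large m see the set where p is smallest.\<close>

sublocale weighted: weighted_powr M w q "1 / (pp - 1)" "1 / (pm - 1)"
  "min 1 (1 / C) powr (1 / (pm - 1))" "max 1 (1 / c) powr (1 / (pm - 1))"
proof (intro weighted_powr.intro weighted_powr_axioms.intro)
  show "0 < 1 / (pp - 1)" using pm pm_pp by simp
  show "0 < min 1 (1 / C) powr (1 / (pm - 1))" using c cC by (auto simp: min_def)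
qed (fact finite_measure_axioms w_meas q_meas w_ge w_le q_ge q_le mass_pos)+

sublocale unweighted: weighted_powr M "\<lambda>_. 1" q "1 / (pp - 1)" "1 / (pm - 1)" 1 1
proof (intro weighted_powr.intro weighted_powr_axioms.intro)
  show "0 < 1 / (pp - 1)" using pm pm_pp by simp
qed (fact finite_measure_axioms q_meas q_ge q_le mass_pos | simp)+

section \<open>Variable exponent spaces and energy integrals\<close>

lemma bounded_in_Lp_var:
  assumes "f \<in> borel_measurable M" "AE x in M. \<bar>f x\<bar> \<le> B"
  shows "f \<in> Lp_var a b p"
proof -
  have "integrable M (\<lambda>x. \<bar>1 * f x\<bar> powr p x)"
  proof (rule integrable_const_bound)
    show "AE x in M. norm (\<bar>1 * f x\<bar> powr p x) \<le> max 1 B powr pp"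
      using assms(2) p_ge p_le
    proof eventually_elim
      case (elim x)
      have "\<bar>f x\<bar> powr p x \<le> max 1 B powr p x" using elim pm by (intro powr_mono2) auto
      also have "\<dots> \<le> max 1 B powr pp" using elim by (intro powr_mono) auto
      finally show ?case by simp
    qed
  qed (use assms(1) p_meas in measurable)
  then show ?thesis using assms(1) by (auto simp: Lp_var_def intro!: exI[of _ 1])
qed

text \<open>Boundedness of p removes the scale e, as e^(-p) is at most e^(-pm) + e^(-pp).
  Integrability of f itself follows from |f| \<le> 1 + |f|^p on a space of finite measure.\<close>

lemma Lp_var_integrable:
  assumes "f \<in> Lp_var a b p"
  shows "integrable M (\<lambda>x. \<bar>f x\<bar> powr p x)" "integrable M f"
proof -
  obtain e where f: "f \<in> borel_measurable M" and e: "0 < e" "integrable M (\<lambda>x. \<bar>e * f x\<bar> powr p x)"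
    using assms by (auto simp: Lp_var_def)
  show i: "integrable M (\<lambda>x. \<bar>f x\<bar> powr p x)"
  proof (rule Bochner_Integration.integrable_bound)
    show "integrable M (\<lambda>x. (inverse e powr pm + inverse e powr pp) * \<bar>e * f x\<bar> powr p x)"
      using e(2) by (rule integrable_mult_right)
    show "AE x in M. norm (\<bar>f x\<bar> powr p x)
        \<le> norm ((inverse e powr pm + inverse e powr pp) * \<bar>e * f x\<bar> powr p x)"
      using p_ge p_le
    proof eventually_elim
      case (elim x)
      have "\<bar>f x\<bar> = inverse e * \<bar>e * f x\<bar>" using e(1) by (simp add: abs_mult)
      then have "\<bar>f x\<bar> powr p x = inverse e powr p x * \<bar>e * f x\<bar> powr p x"
        using e(1) by (metis abs_ge_zero inverse_nonnegative_iff_nonnegative less_imp_le powr_mult)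
      also have "\<dots> \<le> (inverse e powr pm + inverse e powr pp) * \<bar>e * f x\<bar> powr p x"
        using e(1) elim by (intro mult_right_mono powr_le_powr_add) auto
      finally show ?case by simp
    qed
  qed (use f p_meas in measurable)
  show "integrable M f"
  proof (rule Bochner_Integration.integrable_bound)
    show "integrable M (\<lambda>x. 1 + \<bar>f x\<bar> powr p x)" using i by simp
    show "AE x in M. norm (f x) \<le> norm (1 + \<bar>f x\<bar> powr p x)"
      using p_ge
    proof eventually_elim
      case (elim x)
      have "\<bar>f x\<bar> \<le> 1 + \<bar>f x\<bar> powr p x"
      proof (cases "\<bar>f x\<bar> \<le> 1")
        case False
        then have "\<bar>f x\<bar> powr 1 \<le> \<bar>f x\<bar> powr p x" using elim pm by (intro powr_mono) auto
        then show ?thesis using False by simp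
      qed (simp add: add_increasing2)
      then show ?case by simp
    qed
  qed (rule f)
qed

text \<open>A priori the chosen \<open>weak_deriv\<close> is only locally integrable. Uniqueness
  identifies it almost everywhere with the representative h from the Sobolev space, which carries
  over measurability and integrability.\<close>

lemma W1p_weak_deriv:
  assumes v: "v \<in> W1p_var a b p" "has_boundary_values a b v A B"
  shows "has_weak_deriv a b v (weak_deriv a b v)" "weak_deriv a b v \<in> borel_measurable M"
    "integrable M (\<lambda>x. \<bar>weak_deriv a b v x\<bar> powr p x)" "integrable M (weak_deriv a b v)"
    "(\<integral>x. weak_deriv a b v x \<partial>M) = B - A"
    "has_weak_deriv a b v g \<Longrightarrow> AE x in M. weak_deriv a b v x = g x"
proof -
  obtain h where h: "has_weak_deriv a b v h" "h \<in> Lp_var a b p" using v(1) by (auto simp: W1p_var_def)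
  obtain v' where v': "continuous_on {a..b} v'" "AE x in M. v x = v' x" "v' a = A" "v' b = B"
    using v(2) by (auto simp: has_boundary_values_def)
  show w: "has_weak_deriv a b v (weak_deriv a b v)" unfolding weak_deriv_def using h(1) by (rule someI[of "has_weak_deriv a b v"])
  show uniq: "AE x in M. weak_deriv a b v x = g x" if "has_weak_deriv a b v g" for g
    by (rule weak_deriv_unique_AE[OF w that v'(2,1)])
  have ae: "AE x in M. h x = weak_deriv a b v x" using uniq[OF h(1)] by eventually_elim simp
  have hm: "h \<in> borel_measurable M" using h(2) by (simp add: Lp_var_def)
  show m: "weak_deriv a b v \<in> borel_measurable M"
  proof -
    \<comment> \<open>Almost everywhere equality preserves Lebesgue measurability on the whole line,
      hence the extension by zero.\<close>
    have "AE x in lebesgue. indicator {a<..<b} x *\<^sub>R h x = indicator {a<..<b} x *\<^sub>R weak_deriv a b v x"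
      using ae by (subst (asm) AE_restrict_space_iff) (auto elim!: eventually_mono simp: indicator_def)
    from borel_measurable_AE[OF _ this]
    have "(\<lambda>x. indicator {a<..<b} x *\<^sub>R weak_deriv a b v x) \<in> borel_measurable lebesgue"
      using hm by (subst (asm) borel_measurable_restrict_space_iff) auto
    then show ?thesis by (subst borel_measurable_restrict_space_iff) auto
  qed
  show i: "integrable M (weak_deriv a b v)"
    by (rule integrable_cong_AE_imp[OF Lp_var_integrable(2)[OF h(2)] m ae])
  show "integrable M (\<lambda>x. \<bar>weak_deriv a b v x\<bar> powr p x)"
  proof (rule integrable_cong_AE_imp[OF Lp_var_integrable(1)[OF h(2)]])
    show "(\<lambda>x. \<bar>weak_deriv a b v x\<bar> powr p x) \<in> borel_measurable M"
      using m p_meas by measurable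
    show "AE x in M. \<bar>h x\<bar> powr p x = \<bar>weak_deriv a b v x\<bar> powr p x"
      using ae by eventually_elim simp
  qed
  show "(\<integral>x. weak_deriv a b v x \<partial>M) = B - A"
    using weak_deriv_integral[OF ab w i v'(2,1)] v'(3,4) by simp
qed

text \<open>Integrals of nonintegrable functions default to 0, so this has to precede any comparison
  of energies.\<close>

lemma energy_integrable:
  assumes f: "f \<in> borel_measurable M" "integrable M (\<lambda>x. \<bar>f x\<bar> powr p x)"
  shows "integrable M (\<lambda>x. \<gamma> x / p x * \<bar>f x\<bar> powr p x)"
proof (rule Bochner_Integration.integrable_bound)
  show "integrable M (\<lambda>x. C * \<bar>f x\<bar> powr p x)" using f(2) by (rule integrable_mult_right)
  show "AE x in M. norm (\<gamma> x / p x * \<bar>f x\<bar> powr p x) \<le> norm (C * \<bar>f x\<bar> powr p x)"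
    using p_ge \<gamma>_ge \<gamma>_le
  proof eventually_elim
    case (elim x)
    have "\<gamma> x / p x \<le> C / 1" using elim c pm by (intro frac_le) auto
    then have "\<gamma> x / p x * \<bar>f x\<bar> powr p x \<le> C * \<bar>f x\<bar> powr p x"
      by (intro mult_right_mono) auto
    moreover have "0 \<le> \<gamma> x / p x" "0 \<le> C" using elim c cC pm by auto
    ultimately show ?case by (simp only: norm_mult real_norm_def abs_of_nonneg mult_nonneg_nonneg powr_ge_zero)
  qed
qed (use f p_meas \<gamma>_meas in measurable)

section \<open>The minimizer with given flux\<close>

context
  fixes k m :: real
  assumes k: "0 < k" and km: "m = weighted.F k"
begin

definition g where "g = (\<lambda>x. w x * k powr q x)"

lemma g_integrable: "integrable M g"
  unfolding g_def by (rule weighted.integrable_F[OF k])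

lemma g_integral: "(\<integral>x. g x \<partial>M) = m"
  by (simp add: g_def km weighted.F_def)

text \<open>Since q (p - 1) = 1, raising g to the power p - 1 gives k/\<gamma>. The second conjunct
  is the slope of the tangent; the third turns the integral of \<open>\<gamma> * g powr p\<close>
  into k m.\<close>

lemma g_flux: "AE x in M. 0 < g x \<and> \<gamma> x * g x powr (p x - 1) = k \<and> \<gamma> x * g x powr p x = k * g x"
  using p_ge \<gamma>_ge
proof eventually_elim
  case (elim x)
  have pos: "0 < \<gamma> x" "p x \<noteq> 1" using elim c pm by auto
  have g: "g x = (k / \<gamma> x) powr q x" using pos k by (simp add: g_def w_def powr_minus powr_divide divide_simps)
  have "g x powr (p x - 1) = k / \<gamma> x" unfolding g q_def using pos k by (simp add: powr_powr)
  then have a: "\<gamma> x * g x powr (p x - 1) = k" using pos by simp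
  have gp: "0 < g x" using pos k by (simp add: g)
  have "g x powr p x = g x powr (p x - 1) * g x" using gp by (simp add: powr_diff)
  then show ?case using a gp by (simp flip: mult.assoc)
qed

lemma g_Lp: "g \<in> Lp_var a b p"
  by (rule bounded_in_Lp_var[OF borel_measurable_integrable[OF g_integrable]])
    (use weighted.AE_bound[OF k] in \<open>simp add: g_def\<close>)

text \<open>The energy density lies above its tangent at \<open>g\<close>, whose slope is the constant flux \<open>k\<close>;
  hence the linear term integrates to zero for every competitor.\<close>

lemma energy_tangent:
  assumes v: "v \<in> W1p_var a b p" "has_boundary_values a b v A (A + m)"
  shows "(\<integral>x. \<gamma> x / p x * g x powr p x \<partial>M) \<le> energy a b p \<gamma> v"
    and "(\<integral>x. \<gamma> x / p x * g x powr p x \<partial>M) = energy a b p \<gamma> v \<Longrightarrow> AE x in M. weak_deriv a b v x = g x"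
proof -
  let ?D = "weak_deriv a b v"
  note D = W1p_weak_deriv[OF v]
  have i1: "integrable M (\<lambda>x. \<gamma> x / p x * \<bar>g x\<bar> powr p x)"
    by (rule energy_integrable[OF borel_measurable_integrable[OF g_integrable] Lp_var_integrable(1)[OF g_Lp]])
  have abs_g: "AE x in M. \<bar>g x\<bar> = g x" using g_flux by eventually_elim auto
  have gm: "g \<in> borel_measurable M" by (rule borel_measurable_integrable[OF g_integrable])
  have i2: "integrable M (\<lambda>x. \<gamma> x / p x * g x powr p x)"
    by (rule integrable_cong_AE_imp[OF i1])
      (use abs_g gm p_meas \<gamma>_meas in \<open>auto elim!: eventually_mono\<close>)
  have i3: "integrable M (\<lambda>x. k * (?D x - g x))" using D(4) g_integrable by simp
  let ?L = "\<lambda>x. \<gamma> x / p x * g x powr p x + k * (?D x - g x)"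
  let ?R = "\<lambda>x. \<gamma> x / p x * \<bar>?D x\<bar> powr p x"
  have iL: "integrable M ?L" using i2 i3 by simp
  have iR: "integrable M ?R" by (rule energy_integrable[OF D(2,3)])
  have intL: "(\<integral>x. ?L x \<partial>M) = (\<integral>x. \<gamma> x / p x * g x powr p x \<partial>M)"
    using i2 i3 D(4,5) g_integrable g_integral by simp
  have tangent: "AE x in M. ?L x \<le> ?R x \<and> (?L x = ?R x \<longrightarrow> ?D x = g x)"
    using g_flux p_ge \<gamma>_ge
  proof eventually_elim
    case (elim x)
    have pos: "0 < \<gamma> x / p x" "0 < g x" "1 < p x" using elim c pm by auto
    have "\<gamma> x / p x * (p x * g x powr (p x - 1) * (?D x - g x)) = (\<gamma> x * g x powr (p x - 1)) * (?D x - g x)"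
      using pos by simp
    then have L: "?L x = \<gamma> x / p x * (g x powr p x + p x * g x powr (p x - 1) * (?D x - g x))"
      using elim by (simp add: distrib_left)
    have "?L x \<le> ?R x" unfolding L using pos by (intro mult_left_mono abs_powr_tangent) auto
    moreover have "?D x = g x" if "?L x = ?R x"
    proof -
      have "\<gamma> x / p x * (g x powr p x + p x * g x powr (p x - 1) * (?D x - g x)) = \<gamma> x / p x * \<bar>?D x\<bar> powr p x"
        using that unfolding L .
      then have "g x powr p x + p x * g x powr (p x - 1) * (?D x - g x) = \<bar>?D x\<bar> powr p x"
        using pos by (simp only: mult_cancel_left) auto
      then show ?thesis using abs_powr_tangent(2)[OF pos(2,3)] by blast
    qed
    ultimately show ?case by blast
  qed
  have le: "AE x in M. ?L x \<le> ?R x" using tangent by eventually_elim blast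
  show "(\<integral>x. \<gamma> x / p x * g x powr p x \<partial>M) \<le> energy a b p \<gamma> v"
    unfolding energy_def intL[symmetric] by (rule integral_mono_AE[OF iL iR le])
  assume "(\<integral>x. \<gamma> x / p x * g x powr p x \<partial>M) = energy a b p \<gamma> v"
  \<comment> \<open>Ordered integrands with equal integrals agree almost everywhere, which is the
    equality case of the tangent inequality.\<close>
  then have "AE x in M. ?L x = ?R x"
    using intL by (intro integral_ineq_eq_0_then_AE[OF le iL iR]) (simp add: energy_def)
  with tangent show "AE x in M. ?D x = g x" by eventually_elim blast
qed

lemma power_integral:
  assumes f: "f \<in> borel_measurable M" "AE x in M. f x = g x"
  shows "(\<integral>x. \<gamma> x * \<bar>f x\<bar> powr p x \<partial>M) = k * m"
proof -
  have "(\<integral>x. \<gamma> x * \<bar>f x\<bar> powr p x \<partial>M) = (\<integral>x. k * g x \<partial>M)"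
  proof (rule integral_cong_AE)
    show "AE x in M. \<gamma> x * \<bar>f x\<bar> powr p x = k * g x"
      using f(2) g_flux by eventually_elim auto
    show "(\<lambda>x. k * g x) \<in> borel_measurable M" using g_integrable by simp
  qed (use f p_meas \<gamma>_meas in measurable)
  then show ?thesis by (simp add: g_integral)
qed

text \<open>The antiderivative of g starting at A is admissible, and uniqueness of weak derivatives
  shows that its energy attains the lower bound from the tangent inequality.\<close>

lemma minimizer_exists:
  "\<exists>u. is_minimizer a b p \<gamma> A (A + m) u \<and> energy a b p \<gamma> u = (\<integral>x. \<gamma> x / p x * g x powr p x \<partial>M)"
proof -
  define u where "u = (\<lambda>x. A + (\<integral>t. (if t < x then g t else 0) \<partial>M))"
  have u: "continuous_on {a..b} u" "u a = A" "u b = A + m" "has_weak_deriv a b u g"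
    unfolding u_def
    using indefinite_integral_lebesgue[OF ab g_integrable] has_weak_deriv_indefinite_integral[OF ab g_integrable]
      g_integral by auto
  obtain B where "\<forall>y\<in>u ` {a..b}. norm y \<le> B"
    using compact_imp_bounded[OF compact_continuous_image[OF u(1)]] by (auto simp: bounded_iff)
  then have B: "\<bar>u x\<bar> \<le> B" if "x \<in> {a..b}" for x using that by auto
  have "u \<in> Lp_var a b p"
  proof (rule bounded_in_Lp_var)
    show "u \<in> borel_measurable M"
      by (rule borel_measurable_integrable[OF integral_lebesgue_Ioo_continuous(1)[OF u(1)]])
    show "AE x in M. \<bar>u x\<bar> \<le> B" by (rule AE_I2) (use B in auto)
  qed
  then have W: "u \<in> W1p_var a b p" using u(4) g_Lp by (auto simp: W1p_var_def)
  have bv: "has_boundary_values a b u A (A + m)"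
    unfolding has_boundary_values_def using u(1-3) by (intro exI[of _ u]) auto
  have ae: "AE x in M. weak_deriv a b u x = g x" using W1p_weak_deriv(6)[OF W bv u(4)] .
  have "energy a b p \<gamma> u = (\<integral>x. \<gamma> x / p x * g x powr p x \<partial>M)"
    unfolding energy_def
  proof (rule integral_cong_AE)
    show "AE x in M. \<gamma> x / p x * \<bar>weak_deriv a b u x\<bar> powr p x = \<gamma> x / p x * g x powr p x"
      using ae g_flux by eventually_elim auto
  qed (use W1p_weak_deriv(2)[OF W bv] borel_measurable_integrable[OF g_integrable] p_meas \<gamma>_meas in measurable)
  moreover from this have "is_minimizer a b p \<gamma> A (A + m) u"
    unfolding is_minimizer_def using W bv energy_tangent(1) by auto
  ultimately show ?thesis by blast
qed

text \<open>Every minimizer has the energy of the explicit one, hence falls into the equality case: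
  its derivative is g almost everywhere, and the described value is unique.\<close>

lemma DN_map_eq: "DN_map a b p \<gamma> A (A + m) = k * m"
proof -
  obtain u where u: "is_minimizer a b p \<gamma> A (A + m) u"
      "energy a b p \<gamma> u = (\<integral>x. \<gamma> x / p x * g x powr p x \<partial>M)"
    using minimizer_exists by blast
  have val: "(\<integral>x. \<gamma> x * \<bar>weak_deriv a b v x\<bar> powr p x \<partial>M) = k * m"
    if v: "is_minimizer a b p \<gamma> A (A + m) v" for v
  proof -
    have W: "v \<in> W1p_var a b p" "has_boundary_values a b v A (A + m)" and "energy a b p \<gamma> v \<le> energy a b p \<gamma> u"
      using u(1) v by (auto simp: is_minimizer_def)
    then have "(\<integral>x. \<gamma> x / p x * g x powr p x \<partial>M) = energy a b p \<gamma> v"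
      using energy_tangent(1)[OF W] u(2) by simp
    from energy_tangent(2)[OF W this] show ?thesis
      by (rule power_integral[OF W1p_weak_deriv(2)[OF W]])
  qed
  show ?thesis unfolding DN_map_def
    by (rule the_equality) (use u(1) val in \<open>auto intro!: exI[of _ u]\<close>)
qed

lemma DN_diff_eq: "DN_diff a b p \<gamma> m = k * m"
  unfolding DN_diff_def
proof (rule the_equality)
  show "\<forall>A B. B - A = m \<longrightarrow> DN_map a b p \<gamma> A B = k * m"
  proof (intro allI impI)
    fix A B :: real assume "B - A = m"
    then have "B = A + m" by simp
    then show "DN_map a b p \<gamma> A B = k * m" by (simp add: DN_map_eq)
  qed
  fix L assume "\<forall>A B. B - A = m \<longrightarrow> DN_map a b p \<gamma> A B = L"
  then have "DN_map a b p \<gamma> 0 (0 + m) = L" by simp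
  then show "L = k * m" by (simp only: DN_map_eq)
qed

end

section \<open>\<open>Kbar\<close>, the flux and the two limits\<close>

lemma is_Kbar_iff: "is_Kbar a b p m K \<longleftrightarrow> 0 < K \<and> m = unweighted.F K"
  unfolding is_Kbar_def unweighted.F_def by (simp add: q_def)

lemma Kbar_ex1: "0 < m \<Longrightarrow> \<exists>!K. is_Kbar a b p m K"
  unfolding is_Kbar_iff by (rule unweighted.F_ex1)

lemma Kbar: "0 < m \<Longrightarrow> 0 < Kbar a b p m \<and> m = unweighted.F (Kbar a b p m)"
  using theI'[OF Kbar_ex1] by (simp add: Kbar_def is_Kbar_iff)

definition flux :: "real \<Rightarrow> real" where
  "flux m = (THE K. 0 < K \<and> m = weighted.F K)"

lemma flux: "0 < m \<Longrightarrow> 0 < flux m \<and> m = weighted.F (flux m)"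
  unfolding flux_def by (rule theI'[OF weighted.F_ex1])

lemma level_set_meas: "{x \<in> {a<..<b}. p x = r} \<in> sets lebesgue"
proof -
  have "{x \<in> space M. p x = r} \<in> sets M" using p_meas by measurable
  then show ?thesis by (simp add: sets_restrict_space_iff)
qed

lemma integral_level_set:
  fixes f :: "real \<Rightarrow> real"
  assumes "1 < r"
  shows "(\<integral>x. f x * indicator {x. q x = 1 / (r - 1)} x \<partial>M)
    = (\<integral>x. f x \<partial>lebesgue_on {x \<in> {a<..<b}. p x = r})"
proof -
  have "q x = 1 / (r - 1) \<longleftrightarrow> p x = r" for x
    \<comment> \<open>At p x = 1 division by zero gives q x = 0, which differs from the positive
      number 1/(r - 1).\<close>
    using assms by (cases "p x = 1") (auto simp: q_def field_simps)
  then have eq: "{x. q x = 1 / (r - 1)} = {x. p x = r}" by auto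
  have "(\<integral>x. f x * indicator {x. p x = r} x \<partial>M)
      = (\<integral>x. indicator {a<..<b} x *\<^sub>R (f x * indicator {x. p x = r} x) \<partial>lebesgue)"
    by (subst integral_restrict_space) auto
  also have "\<dots> = (\<integral>x. indicator {x \<in> {a<..<b}. p x = r} x *\<^sub>R f x \<partial>lebesgue)"
    by (intro Bochner_Integration.integral_cong) (auto simp: indicator_def)
  also have "\<dots> = (\<integral>x. f x \<partial>lebesgue_on {x \<in> {a<..<b}. p x = r})"
    using level_set_meas by (subst integral_restrict_space) auto
  finally show ?thesis unfolding eq .
qed

text \<open>Supplies the nonzero limit by which the comparison divides: the weight is bounded below
  by a positive constant on a set of positive measure.\<close>

lemma integral_w_pos:
  assumes "1 < r" and pos: "0 < measure lebesgue {x \<in> {a<..<b}. p x = r}"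
  shows "0 < (\<integral>x. w x \<partial>lebesgue_on {x \<in> {a<..<b}. p x = r})"
proof -
  let ?Q = "{x \<in> {a<..<b}. p x = r}" and ?w0 = "min 1 (1 / C) powr (1 / (pm - 1))"
  have "bounded ?Q" by (rule bounded_subset[of "{a<..<b}"]) auto
  then have fin: "finite_measure (lebesgue_on ?Q)"
    by (intro finite_measure_lebesgue_on bounded_set_imp_lmeasurable level_set_meas)
  have ae: "AE x in lebesgue_on ?Q. P x" if "AE x in M. P x" for P
    using that level_set_meas by (auto simp: AE_restrict_space_iff elim!: eventually_mono)
  have "w \<in> borel_measurable (lebesgue_on ?Q)"
    by (rule measurable_restrict_mono[OF w_meas]) auto
  moreover have "AE x in lebesgue_on ?Q. norm (w x) \<le> max 1 (1 / c) powr (1 / (pm - 1))"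
    using ae[OF w_le] by eventually_elim (simp add: w_def)
  ultimately have i: "integrable (lebesgue_on ?Q) w"
    using finite_measure.integrable_const_bound[OF fin] by blast
  have "0 < ?w0 * measure lebesgue ?Q"
    using pos c cC by (intro mult_pos_pos) (auto simp: min_def)
  also have "\<dots> = (\<integral>x. ?w0 \<partial>lebesgue_on ?Q)"
    using level_set_meas by (simp add: measure_restrict_space mult.commute)
  also have "\<dots> \<le> (\<integral>x. w x \<partial>lebesgue_on ?Q)"
    by (rule integral_mono_AE[OF finite_measure.integrable_const[OF fin] i ae[OF w_ge]])
  finally show ?thesis .
qed

text \<open>Serves both limits: \<F> is the filter of m, \<G> that of the two constants, and r the
  extreme value of p. With \<beta> = 1/(r - 1) the exponents 1 + \<beta> and 1/\<beta> become r/(r -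
  1) and r - 1.\<close>

lemma DN_limit:
  assumes r: "1 < r" and \<F>: "\<forall>\<^sub>F m in \<F>. 0 < m"
    and pos: "0 < measure lebesgue {x \<in> {a<..<b}. p x = r}"
    and lim_w: "((\<lambda>K. weighted.F K / K powr (1 / (r - 1)))
      \<longlongrightarrow> (\<integral>x. w x * indicator {x. q x = 1 / (r - 1)} x \<partial>M)) \<G>" "filterlim flux \<G> \<F>"
    and lim_1: "((\<lambda>K. unweighted.F K / K powr (1 / (r - 1)))
      \<longlongrightarrow> (\<integral>x. 1 * indicator {x. q x = 1 / (r - 1)} x \<partial>M)) \<G>" "filterlim (Kbar a b p) \<G> \<F>"
  defines "Q \<equiv> {x \<in> {a<..<b}. p x = r}"
  shows "((\<lambda>m. Kbar a b p m powr (- (r / (r - 1))) * (1 / measure lebesgue Q) * DN_diff a b p \<gamma> m)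
      \<longlongrightarrow> (1 / measure lebesgue Q * (\<integral>x. \<gamma> x powr (- (1 / (p x - 1))) \<partial>lebesgue_on Q)) powr (- (r - 1))) \<F>"
proof -
  have W: "((\<lambda>m. m / flux m powr (1 / (r - 1))) \<longlongrightarrow> (\<integral>x. w x \<partial>lebesgue_on Q)) \<F>"
  proof (rule Lim_transform_eventually)
    show "((\<lambda>m. weighted.F (flux m) / flux m powr (1 / (r - 1))) \<longlongrightarrow> (\<integral>x. w x \<partial>lebesgue_on Q)) \<F>"
      using filterlim_compose[OF lim_w] r by (simp only: integral_level_set Q_def)
    show "\<forall>\<^sub>F m in \<F>. weighted.F (flux m) / flux m powr (1 / (r - 1)) = m / flux m powr (1 / (r - 1))"
      using \<F> by eventually_elim (simp only: flux[THEN conjunct2, symmetric])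
  qed
  have "(\<integral>x. 1 \<partial>lebesgue_on Q) = measure lebesgue Q"
    using level_set_meas by (simp add: measure_restrict_space Q_def)
  then have one: "((\<lambda>m. unweighted.F (Kbar a b p m) / Kbar a b p m powr (1 / (r - 1))) \<longlongrightarrow> measure lebesgue Q) \<F>"
    using filterlim_compose[OF lim_1] r by (simp only: integral_level_set Q_def)
  have V: "((\<lambda>m. m / Kbar a b p m powr (1 / (r - 1))) \<longlongrightarrow> measure lebesgue Q) \<F>"
    using one
  proof (rule Lim_transform_eventually)
    show "\<forall>\<^sub>F m in \<F>. unweighted.F (Kbar a b p m) / Kbar a b p m powr (1 / (r - 1)) = m / Kbar a b p m powr (1 / (r - 1))"
      using \<F> by eventually_elim (simp only: Kbar[THEN conjunct2, symmetric])
  qed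
  have ev: "\<forall>\<^sub>F m in \<F>. 0 < flux m" "\<forall>\<^sub>F m in \<F>. 0 < Kbar a b p m"
    using \<F> by (eventually_elim, use flux Kbar in blast)+
  have "((\<lambda>m. Kbar a b p m powr (- (1 + 1 / (r - 1))) * (1 / measure lebesgue Q) * (flux m * m))
      \<longlongrightarrow> (1 / measure lebesgue Q * (\<integral>x. w x \<partial>lebesgue_on Q)) powr (- (1 / (1 / (r - 1))))) \<F>"
    by (rule ratio_limit[OF \<F> ev _ _ _ W V]) (use r pos integral_w_pos in \<open>auto simp: Q_def\<close>)
  moreover have "1 + 1 / (r - 1) = r / (r - 1)" using r by (simp add: field_simps)
  ultimately have "((\<lambda>m. Kbar a b p m powr (- (r / (r - 1))) * (1 / measure lebesgue Q) * (flux m * m))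
      \<longlongrightarrow> (1 / measure lebesgue Q * (\<integral>x. w x \<partial>lebesgue_on Q)) powr (- (r - 1))) \<F>"
    by simp
  then show ?thesis unfolding w_def q_def
  proof (rule Lim_transform_eventually)
    show "\<forall>\<^sub>F m in \<F>. Kbar a b p m powr (- (r / (r - 1))) * (1 / measure lebesgue Q) * (flux m * m)
      = Kbar a b p m powr (- (r / (r - 1))) * (1 / measure lebesgue Q) * DN_diff a b p \<gamma> m"
      using \<F>
    proof eventually_elim
      case (elim m)
      then have "DN_diff a b p \<gamma> m = flux m * m" using flux by (intro DN_diff_eq) auto
      then show ?case by simp
    qed
  qed
qed

end

theorem theorem4:
  fixes a b p_minus p_plus :: real
    and p \<gamma> :: "real \<Rightarrow> real"
    and Q_plus Q_minus :: "real set"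
  assumes "a < b"
    and "p \<in> borel_measurable (lebesgue_on {a<..<b})"
    and "ereal p_minus = essinf (lebesgue_on {a<..<b}) (\<lambda>x. ereal (p x))"
    and "ereal p_plus = esssup (lebesgue_on {a<..<b}) (\<lambda>x. ereal (p x))"
    and "1 < p_minus" and "p_minus \<le> p_plus"
    and "\<gamma> \<in> borel_measurable (lebesgue_on {a<..<b})"
    and "\<exists>C. AE x in lebesgue_on {a<..<b}. \<bar>\<gamma> x\<bar> \<le> C"
    and "\<exists>c>0. AE x in lebesgue_on {a<..<b}. c \<le> \<gamma> x"
    and "Q_plus = {x \<in> {a<..<b}. p x = p_minus}" and "0 < measure lebesgue Q_plus"
    and "Q_minus = {x \<in> {a<..<b}. p x = p_plus}" and "0 < measure lebesgue Q_minus"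
  shows "(\<forall>m>0. \<exists>!K. is_Kbar a b p m K) \<and>
    ((\<lambda>m. Kbar a b p m powr (- (p_minus / (p_minus - 1)))
          * (1 / measure lebesgue Q_plus) * DN_diff a b p \<gamma> m)
      \<longlongrightarrow> (1 / measure lebesgue Q_plus
              * (\<integral>x. \<gamma> x powr (- (1 / (p x - 1))) \<partial>lebesgue_on Q_plus))
            powr (- (p_minus - 1))) at_top \<and>
    ((\<lambda>m. Kbar a b p m powr (- (p_plus / (p_plus - 1)))
          * (1 / measure lebesgue Q_minus) * DN_diff a b p \<gamma> m)
      \<longlongrightarrow> (1 / measure lebesgue Q_minus
              * (\<integral>x. \<gamma> x powr (- (1 / (p x - 1))) \<partial>lebesgue_on Q_minus))
            powr (- (p_plus - 1))) (at_right 0)"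
proof -
  let ?M = "lebesgue_on {a<..<b}"
  obtain c C0 where c: "0 < c" "AE x in ?M. c \<le> \<gamma> x" and C0: "AE x in ?M. \<bar>\<gamma> x\<bar> \<le> C0"
    using assms(8,9) by blast
  \<comment> \<open>\<open>essinf\<close> is encoded through the essential supremum of -p, so the
    lower bound on p is read off from an upper bound on -p.\<close>
  have "AE x in ?M. - ereal (p x) \<le> - ereal p_minus"
    using esssup_AE[of "\<lambda>x. - ereal (p x)" ?M] assms(3)
    by (simp add: essinf_def ereal_uminus_eq_reorder)
  then have p_ge: "AE x in ?M. p_minus \<le> p x" by simp
  have "AE x in ?M. ereal (p x) \<le> ereal p_plus"
    using esssup_AE[of "\<lambda>x. ereal (p x)" ?M] unfolding assms(4)[symmetric] .
  then have p_le: "AE x in ?M. p x \<le> p_plus" by simp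
  interpret DN_problem a b p \<gamma> p_minus p_plus c C0
    using assms(1,2,5,7) c C0 p_ge p_le by unfold_locales (auto elim: eventually_mono)
  have Q: "0 < measure lebesgue {x \<in> {a<..<b}. p x = p_minus}" "0 < measure lebesgue {x \<in> {a<..<b}. p x = p_plus}"
    using assms(10-13) by simp_all
  have "1 < p_plus" using assms(5,6) by simp
  show ?thesis
    unfolding assms(10) assms(12)
  proof (intro conjI allI impI)
    show "\<exists>!K. is_Kbar a b p m K" if "0 < m" for m using Kbar_ex1 that .
    show "((\<lambda>m. Kbar a b p m powr (- (p_minus / (p_minus - 1))) * (1 / measure lebesgue {x \<in> {a<..<b}. p x = p_minus}) * DN_diff a b p \<gamma> m)
      \<longlongrightarrow> (1 / measure lebesgue {x \<in> {a<..<b}. p x = p_minus}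
          * (\<integral>x. \<gamma> x powr (- (1 / (p x - 1))) \<partial>lebesgue_on {x \<in> {a<..<b}. p x = p_minus})) powr (- (p_minus - 1))) at_top"
      by (rule DN_limit[OF assms(5) eventually_gt_at_top Q(1)
            weighted.F_asymp_at_top weighted.inverse_at_top[OF flux]
            unweighted.F_asymp_at_top unweighted.inverse_at_top[OF Kbar]])
    \<comment> \<open>Small m means small flux, where the smallest exponent q = 1/(p_plus - 1)
      leads; it is attained where p is maximal.\<close>
    show "((\<lambda>m. Kbar a b p m powr (- (p_plus / (p_plus - 1))) * (1 / measure lebesgue {x \<in> {a<..<b}. p x = p_plus}) * DN_diff a b p \<gamma> m)
      \<longlongrightarrow> (1 / measure lebesgue {x \<in> {a<..<b}. p x = p_plus}
          * (\<integral>x. \<gamma> x powr (- (1 / (p x - 1))) \<partial>lebesgue_on {x \<in> {a<..<b}. p x = p_plus})) powr (- (p_plus - 1))) (at_right 0)"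
      by (rule DN_limit[OF \<open>1 < p_plus\<close> eventually_at_right_less Q(2)
            weighted.F_asymp_at_right_0 weighted.inverse_at_right_0[OF flux]
            unweighted.F_asymp_at_right_0 unweighted.inverse_at_right_0[OF Kbar]])
  qed
qed

end
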